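(* Let $\mathbb{K}$ be a field, $H$ a $\mathbb{K}$-bialgebra with comultiplication $\Delta$, counit $\varepsilon$ and unit $\eta$, $A$ a $\mathbb{K}$-algebra, $\delta:A\to H\otimes A$ an algebra left coaction of $H$ on $A$, $M$ a left $A$-module, and $$\Theta:H\otimes M=(\eta\otimes\mathrm{id}_A)^\ast M\to\delta^\ast M=(H\otimes A)_\delta\otimes_A M$$ a left $(H\otimes A)$-module homomorphism. If $\Theta$ is an isomorphism and $\overline\delta:M\to H\otimes M$, $\overline\delta(m):=\Theta^{-1}(1\otimes m)$, is the module homomorphism over $\delta$ corresponding to $\Theta^{-1}$ via $\delta$, then $$(\varepsilon\otimes\mathrm{id}_A)^\ast\Theta=\mathrm{id}_M\iff(\varepsilon\otimes\mathrm{id}_M)\circ\overline\delta=\mathrm{id}_M .$$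
   Context: Unadorned tensor products are over $\mathbb{K}$; algebras are associative and unital, modules unital; $\mathbb{K}\otimes M=M$. An algebra left coaction $\delta:A\to H\otimes A$ is a $\mathbb{K}$-algebra homomorphism with $(\Delta\otimes\mathrm{id}_A)\circ\delta=(\mathrm{id}_H\otimes\delta)\circ\delta$ and $(\varepsilon\otimes\mathrm{id}_A)\circ\delta=\mathrm{id}_A$ (with $\mathbb{K}\otimes A=A$). For a $\mathbb{K}$-algebra homomorphism $\varphi:A\to B$ and a left $A$-module $M$, $\varphi^\ast M:=B\otimes_A M$ ($B$ being a right $A$-module via $\varphi$), a left $B$-module, with natural map $M\to\varphi^\ast M$, $m\mapsto 1\otimes m$; for an $A$-module homomorphism $g$, $\varphi^\ast g:=\mathrm{id}_B\otimes_A g$. A module homomorphism over $\varphi$ from an $A$-module $M$ to a $B$-module $N$ is an additive map $\overline\varphi:M\to N$ with $\overline\varphi(am)=\varphi(a)\overline\varphi(m)$; it corresponds via $\varphi$ to the $B$-module homomorphism $f:\varphi^\ast M\to N$ with $f(1\otimes m)=\overline\varphi(m)$. $(H\otimes A)_\delta$ denotes $H\otimes A$ with the right $A$-module structure induced by $\delta$. $H\otimes M$ is a left $(H\otimes A)$-module by $(h\otimes a)(h'\otimes m)=hh'\otimes am$ and is identified with $(\eta\otimes\mathrm{id}_A)^\ast M$ (where $\eta\otimes\mathrm{id}_A:A\to H\otimes A$, $a\mapsto 1\otimes a$) via $(h\otimes a)\otimes m=h\otimes am$. Since $(\varepsilon\otimes\mathrm{id}_A)\circ(\eta\otimes\mathrm{id}_A)=\mathrm{id}_A=(\varepsilon\otimes\mathrm{id}_A)\circ\delta$,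 one identifies $(\varepsilon\otimes\mathrm{id}_A)^\ast(\eta\otimes\mathrm{id}_A)^\ast M=M$ (with natural map $H\otimes M\to M$, $h\otimes m\mapsto\varepsilon(h)m$) and $(\varepsilon\otimes\mathrm{id}_A)^\ast\delta^\ast M=M$ (so that the composite of natural maps $M\to\delta^\ast M\to M$ is $\mathrm{id}_M$); thus $(\varepsilon\otimes\mathrm{id}_A)^\ast\Theta$ is a map $M\to M$. *)

theory Defs
  imports "HOL-Algebra.Module" "HOL-Algebra.Generated_Groups" "HOL-Algebra.Free_Abelian_Groups"
begin

section \<open>Modules over a noncommutative ring\<close>

text \<open>The locale \<^locale>\<open>module\<close> of HOL-Algebra requires a commutative ring of scalars.  As there,
  the fields \<open>mult\<close> and \<open>one\<close> of the record carry no meaning when it is used as a mere module.\<close>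

locale left_module = R: ring R + M: abelian_group M
  for R :: "('r, 'p) ring_scheme" (structure) and M :: "('r, 'm, 's) module_scheme" (structure) +
  assumes smult_closed:
      "\<lbrakk>a \<in> carrier R; x \<in> carrier M\<rbrakk> \<Longrightarrow> a \<odot>\<^bsub>M\<^esub> x \<in> carrier M"
    and smult_l_distr:
      "\<lbrakk>a \<in> carrier R; b \<in> carrier R; x \<in> carrier M\<rbrakk> \<Longrightarrow>
       (a \<oplus>\<^bsub>R\<^esub> b) \<odot>\<^bsub>M\<^esub> x = a \<odot>\<^bsub>M\<^esub> x \<oplus>\<^bsub>M\<^esub> b \<odot>\<^bsub>M\<^esub> x"
    and smult_r_distr:
      "\<lbrakk>a \<in> carrier R; x \<in> carrier M; y \<in> carrier M\<rbrakk> \<Longrightarrow>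
       a \<odot>\<^bsub>M\<^esub> (x \<oplus>\<^bsub>M\<^esub> y) = a \<odot>\<^bsub>M\<^esub> x \<oplus>\<^bsub>M\<^esub> a \<odot>\<^bsub>M\<^esub> y"
    and smult_assoc:
      "\<lbrakk>a \<in> carrier R; b \<in> carrier R; x \<in> carrier M\<rbrakk> \<Longrightarrow>
       (a \<otimes>\<^bsub>R\<^esub> b) \<odot>\<^bsub>M\<^esub> x = a \<odot>\<^bsub>M\<^esub> (b \<odot>\<^bsub>M\<^esub> x)"
    and smult_one:
      "x \<in> carrier M \<Longrightarrow> \<one>\<^bsub>R\<^esub> \<odot>\<^bsub>M\<^esub> x = x"

definition left_module_hom ::
    "('r, 'p) ring_scheme \<Rightarrow> ('r, 'x, 'q) module_scheme \<Rightarrow> ('r, 'y, 's) module_scheme \<Rightarrow> ('x \<Rightarrow> 'y) set"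
  where "left_module_hom R X Y =
    {f \<in> hom (add_monoid X) (add_monoid Y).
       \<forall>a\<in>carrier R. \<forall>x\<in>carrier X. f (a \<odot>\<^bsub>X\<^esub> x) = a \<odot>\<^bsub>Y\<^esub> f x}"


section \<open>Tensor products over a noncommutative ring\<close>

text \<open>\<open>X \<otimes>\<^sub>R Y\<close> for a right \<open>R\<close>-module \<open>X\<close> with action \<open>r x c\<close> (meaning \<open>x c\<close>) and a left \<open>R\<close>-module
  \<open>Y\<close>: the free abelian group on the pairs modulo the subgroup generated by the usual relations.
  Its elements are cosets.  The group is written multiplicatively, being a quotient formed with
  \<^const>\<open>FactGroup\<close>.\<close>

definition tensor_relations ::
    "('r, 'p) ring_scheme \<Rightarrow> ('x, 'q) ring_scheme \<Rightarrow> ('x \<Rightarrow> 'r \<Rightarrow> 'x) \<Rightarrow> ('r, 'y, 's) module_scheme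
      \<Rightarrow> ('x \<times> 'y \<Rightarrow>\<^sub>0 int) set"
  where "tensor_relations R X r Y =
    {frag_of (x \<oplus>\<^bsub>X\<^esub> x', y) - frag_of (x, y) - frag_of (x', y) | x x' y.
       x \<in> carrier X \<and> x' \<in> carrier X \<and> y \<in> carrier Y}
    \<union> {frag_of (x, y \<oplus>\<^bsub>Y\<^esub> y') - frag_of (x, y) - frag_of (x, y') | x y y'.
       x \<in> carrier X \<and> y \<in> carrier Y \<and> y' \<in> carrier Y}
    \<union> {frag_of (r x c, y) - frag_of (x, c \<odot>\<^bsub>Y\<^esub> y) | x c y.
       x \<in> carrier X \<and> c \<in> carrier R \<and> y \<in> carrier Y}"

definition tensor_kernel ::
    "('r, 'p) ring_scheme \<Rightarrow> ('x, 'q) ring_scheme \<Rightarrow> ('x \<Rightarrow> 'r \<Rightarrow> 'x) \<Rightarrow> ('r, 'y, 's) module_scheme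
      \<Rightarrow> ('x \<times> 'y \<Rightarrow>\<^sub>0 int) set"
  where "tensor_kernel R X r Y =
    generate (free_Abelian_group (carrier X \<times> carrier Y)) (tensor_relations R X r Y)"

definition tensor_group ::
    "('r, 'p) ring_scheme \<Rightarrow> ('x, 'q) ring_scheme \<Rightarrow> ('x \<Rightarrow> 'r \<Rightarrow> 'x) \<Rightarrow> ('r, 'y, 's) module_scheme
      \<Rightarrow> ('x \<times> 'y \<Rightarrow>\<^sub>0 int) set monoid"
  where "tensor_group R X r Y =
    free_Abelian_group (carrier X \<times> carrier Y) Mod tensor_kernel R X r Y"

definition tensor_elem ::
    "('r, 'p) ring_scheme \<Rightarrow> ('x, 'q) ring_scheme \<Rightarrow> ('x \<Rightarrow> 'r \<Rightarrow> 'x) \<Rightarrow> ('r, 'y, 's) module_scheme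
      \<Rightarrow> 'x \<Rightarrow> 'y \<Rightarrow> ('x \<times> 'y \<Rightarrow>\<^sub>0 int) set"
  where "tensor_elem R X r Y x y =
    tensor_kernel R X r Y #>\<^bsub>free_Abelian_group (carrier X \<times> carrier Y)\<^esub> frag_of (x, y)"

text \<open>The homomorphism from a tensor product to a commutative group \<open>G\<close> with \<open>x \<otimes> y \<mapsto> f x y\<close>, for a
  balanced biadditive \<open>f\<close>: the additive extension of \<open>f\<close> to the free group is constant on each
  coset \<open>t\<close>.\<close>

definition tensor_lift ::
    "('g, 'p) monoid_scheme \<Rightarrow> ('x \<Rightarrow> 'y \<Rightarrow> 'g) \<Rightarrow> ('x \<times> 'y \<Rightarrow>\<^sub>0 int) set \<Rightarrow> 'g"
  where "tensor_lift G f t =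
    the_elem ((\<lambda>p. \<Otimes>\<^bsub>G\<^esub>z\<in>Poly_Mapping.keys p. f (fst z) (snd z) [^]\<^bsub>G\<^esub> Poly_Mapping.lookup p z) ` t)"


section \<open>Extension of scalars\<close>

text \<open>\<open>\<phi>\<^sup>* M = B \<otimes>\<^sub>A M\<close>, where \<open>B\<close> is a right \<open>A\<close>-module via \<open>\<phi>\<close>.\<close>

definition ext_elem ::
    "('a, 'p) ring_scheme \<Rightarrow> ('b, 'q) ring_scheme \<Rightarrow> ('a \<Rightarrow> 'b) \<Rightarrow> ('a, 'm, 's) module_scheme
      \<Rightarrow> 'b \<Rightarrow> 'm \<Rightarrow> ('b \<times> 'm \<Rightarrow>\<^sub>0 int) set"
  where "ext_elem A B \<phi> M = tensor_elem A B (\<lambda>b a. b \<otimes>\<^bsub>B\<^esub> \<phi> a) M"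

definition ext_module ::
    "('a, 'p) ring_scheme \<Rightarrow> ('b, 'q) ring_scheme \<Rightarrow> ('a \<Rightarrow> 'b) \<Rightarrow> ('a, 'm, 's) module_scheme
      \<Rightarrow> ('b, ('b \<times> 'm \<Rightarrow>\<^sub>0 int) set) module"
  where "ext_module A B \<phi> M =
    (let T = tensor_group A B (\<lambda>b a. b \<otimes>\<^bsub>B\<^esub> \<phi> a) M in
     \<lparr>carrier = carrier T, monoid.mult = undefined, one = undefined,
      ring.zero = \<one>\<^bsub>T\<^esub>, ring.add = monoid.mult T,
      smult = (\<lambda>b. tensor_lift T (\<lambda>b' m. ext_elem A B \<phi> M (b \<otimes>\<^bsub>B\<^esub> b') m))\<rparr>)"

definition ext_natural ::
    "('a, 'p) ring_scheme \<Rightarrow> ('b, 'q) ring_scheme \<Rightarrow> ('a \<Rightarrow> 'b) \<Rightarrow> ('a, 'm, 's) module_scheme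
      \<Rightarrow> 'm \<Rightarrow> ('b \<times> 'm \<Rightarrow>\<^sub>0 int) set"
  where "ext_natural A B \<phi> M m = ext_elem A B \<phi> M \<one>\<^bsub>B\<^esub> m"

text \<open>\<open>\<phi>\<^sup>* g = id\<^sub>B \<otimes>\<^sub>A g\<close> for \<open>g : M \<rightarrow> N\<close>.\<close>

definition ext_map ::
    "('a, 'p) ring_scheme \<Rightarrow> ('b, 'q) ring_scheme \<Rightarrow> ('a \<Rightarrow> 'b) \<Rightarrow> ('a, 'n, 's) module_scheme
      \<Rightarrow> ('m \<Rightarrow> 'n) \<Rightarrow> ('b \<times> 'm \<Rightarrow>\<^sub>0 int) set \<Rightarrow> ('b \<times> 'n \<Rightarrow>\<^sub>0 int) set"
  where "ext_map A B \<phi> N g =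
    tensor_lift (add_monoid (ext_module A B \<phi> N)) (\<lambda>b m. ext_elem A B \<phi> N b (g m))"

text \<open>The \<open>B\<close>-module homomorphism \<open>\<phi>\<^sup>* M \<rightarrow> N\<close>, \<open>b \<otimes> m \<mapsto> b g(m)\<close>, corresponding to a module
  homomorphism \<open>g : M \<rightarrow> N\<close> over \<open>\<phi>\<close>.\<close>

definition ext_adjunct :: "('b, 'n, 's) module_scheme \<Rightarrow> ('m \<Rightarrow> 'n) \<Rightarrow> ('b \<times> 'm \<Rightarrow>\<^sub>0 int) set \<Rightarrow> 'n"
  where "ext_adjunct N g = tensor_lift (add_monoid N) (\<lambda>b m. b \<odot>\<^bsub>N\<^esub> g m)"


section \<open>Tensor products over the ground field\<close>

text \<open>Over a commutative ring, the scalar multiplication of \<open>X\<close> serves as the right action.\<close>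

definition ktensor_group ::
    "('k, 'p) ring_scheme \<Rightarrow> ('k, 'x, 'q) module_scheme \<Rightarrow> ('k, 'y, 's) module_scheme
      \<Rightarrow> ('x \<times> 'y \<Rightarrow>\<^sub>0 int) set monoid"
  where "ktensor_group K X Y = tensor_group K X (\<lambda>x c. c \<odot>\<^bsub>X\<^esub> x) Y"

definition ktensor_elem ::
    "('k, 'p) ring_scheme \<Rightarrow> ('k, 'x, 'q) module_scheme \<Rightarrow> ('k, 'y, 's) module_scheme
      \<Rightarrow> 'x \<Rightarrow> 'y \<Rightarrow> ('x \<times> 'y \<Rightarrow>\<^sub>0 int) set"
  where "ktensor_elem K X Y = tensor_elem K X (\<lambda>x c. c \<odot>\<^bsub>X\<^esub> x) Y"

text \<open>\<open>f \<otimes> g : X \<otimes> Y \<rightarrow> X' \<otimes> Y'\<close>.\<close>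

definition ktensor_map ::
    "('k, 'p) ring_scheme \<Rightarrow> ('k, 'x, 'q) module_scheme \<Rightarrow> ('k, 'y, 's) module_scheme
      \<Rightarrow> ('u \<Rightarrow> 'x) \<Rightarrow> ('v \<Rightarrow> 'y) \<Rightarrow> ('u \<times> 'v \<Rightarrow>\<^sub>0 int) set \<Rightarrow> ('x \<times> 'y \<Rightarrow>\<^sub>0 int) set"
  where "ktensor_map K X' Y' f g =
    tensor_lift (ktensor_group K X' Y') (\<lambda>x y. ktensor_elem K X' Y' (f x) (g y))"

definition ground_algebra :: "('k, 'p) ring_scheme \<Rightarrow> ('k, 'k) module"
  where "ground_algebra K =
    \<lparr>carrier = carrier K, monoid.mult = monoid.mult K, one = \<one>\<^bsub>K\<^esub>,
     ring.zero = \<zero>\<^bsub>K\<^esub>, ring.add = ring.add K, smult = monoid.mult K\<rparr>"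

text \<open>The identifications \<open>K \<otimes> Y = Y\<close>, \<open>Y \<otimes> K = Y\<close> and \<open>(X \<otimes> Y) \<otimes> Z = X \<otimes> (Y \<otimes> Z)\<close>; the
  argument \<open>YZ\<close> of the last one is the \<open>K\<close>-module \<open>Y \<otimes> Z\<close>.\<close>

definition left_unitor :: "('k, 'y, 's) module_scheme \<Rightarrow> ('k \<times> 'y \<Rightarrow>\<^sub>0 int) set \<Rightarrow> 'y"
  where "left_unitor Y = tensor_lift (add_monoid Y) (\<lambda>c y. c \<odot>\<^bsub>Y\<^esub> y)"

definition right_unitor :: "('k, 'y, 's) module_scheme \<Rightarrow> ('y \<times> 'k \<Rightarrow>\<^sub>0 int) set \<Rightarrow> 'y"
  where "right_unitor Y = tensor_lift (add_monoid Y) (\<lambda>y c. c \<odot>\<^bsub>Y\<^esub> y)"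

definition associator ::
    "('k, 'p) ring_scheme \<Rightarrow> ('k, 'x, 'q) module_scheme \<Rightarrow> ('k, 'y, 's) module_scheme
      \<Rightarrow> ('k, 'z, 't) module_scheme \<Rightarrow> ('k, ('y \<times> 'z \<Rightarrow>\<^sub>0 int) set, 'v) module_scheme
      \<Rightarrow> (('x \<times> 'y \<Rightarrow>\<^sub>0 int) set \<times> 'z \<Rightarrow>\<^sub>0 int) set \<Rightarrow> ('x \<times> ('y \<times> 'z \<Rightarrow>\<^sub>0 int) set \<Rightarrow>\<^sub>0 int) set"
  where "associator K X Y Z YZ =
    tensor_lift (ktensor_group K X YZ) (\<lambda>t z.
      tensor_lift (ktensor_group K X YZ) (\<lambda>x y. ktensor_elem K X YZ x (ktensor_elem K Y Z y z)) t)"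


section \<open>Algebras, bialgebras and coactions\<close>

text \<open>The locale \<^locale>\<open>algebra\<close> of HOL-Algebra requires a commutative multiplication.\<close>

locale assoc_algebra = module K A + ring A for K (structure) and A (structure) +
  assumes smult_mult_left:
      "\<lbrakk>c \<in> carrier K; x \<in> carrier A; y \<in> carrier A\<rbrakk> \<Longrightarrow>
       (c \<odot>\<^bsub>A\<^esub> x) \<otimes>\<^bsub>A\<^esub> y = c \<odot>\<^bsub>A\<^esub> (x \<otimes>\<^bsub>A\<^esub> y)"
    and smult_mult_right:
      "\<lbrakk>c \<in> carrier K; x \<in> carrier A; y \<in> carrier A\<rbrakk> \<Longrightarrow>
       x \<otimes>\<^bsub>A\<^esub> (c \<odot>\<^bsub>A\<^esub> y) = c \<odot>\<^bsub>A\<^esub> (x \<otimes>\<^bsub>A\<^esub> y)"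

definition algebra_hom ::
    "('k, 'p) ring_scheme \<Rightarrow> ('k, 'a, 'q) module_scheme \<Rightarrow> ('k, 'b, 's) module_scheme \<Rightarrow> ('a \<Rightarrow> 'b) set"
  where "algebra_hom K A B =
    {f \<in> ring_hom A B. \<forall>c\<in>carrier K. \<forall>x\<in>carrier A. f (c \<odot>\<^bsub>A\<^esub> x) = c \<odot>\<^bsub>B\<^esub> f x}"

definition tensor_algebra ::
    "('k, 'p) ring_scheme \<Rightarrow> ('k, 'a, 'q) module_scheme \<Rightarrow> ('k, 'b, 's) module_scheme
      \<Rightarrow> ('k, ('a \<times> 'b \<Rightarrow>\<^sub>0 int) set) module"
  where "tensor_algebra K A B =
    (let T = ktensor_group K A B in
     \<lparr>carrier = carrier T,
      monoid.mult = (\<lambda>s t. tensor_lift T (\<lambda>a b.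
                 tensor_lift T (\<lambda>a' b'. ktensor_elem K A B (a \<otimes>\<^bsub>A\<^esub> a') (b \<otimes>\<^bsub>B\<^esub> b')) t) s),
      one = ktensor_elem K A B \<one>\<^bsub>A\<^esub> \<one>\<^bsub>B\<^esub>,
      ring.zero = \<one>\<^bsub>T\<^esub>, ring.add = monoid.mult T,
      smult = (\<lambda>c. tensor_lift T (\<lambda>a b. ktensor_elem K A B (c \<odot>\<^bsub>A\<^esub> a) b))\<rparr>)"

locale bialgebra = assoc_algebra K H for K (structure) and H (structure) +
  fixes \<Delta> and \<epsilon>
  assumes comult_hom: "\<Delta> \<in> algebra_hom K H (tensor_algebra K H H)"
    and counit_hom: "\<epsilon> \<in> algebra_hom K H (ground_algebra K)"
    and coassoc: "h \<in> carrier H \<Longrightarrow>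
      associator K H H H (tensor_algebra K H H)
        (ktensor_map K (tensor_algebra K H H) H \<Delta> id (\<Delta> h))
      = ktensor_map K H (tensor_algebra K H H) id \<Delta> (\<Delta> h)"
    and counit_left: "h \<in> carrier H \<Longrightarrow>
      left_unitor H (ktensor_map K (ground_algebra K) H \<epsilon> id (\<Delta> h)) = h"
    and counit_right: "h \<in> carrier H \<Longrightarrow>
      right_unitor H (ktensor_map K H (ground_algebra K) id \<epsilon> (\<Delta> h)) = h"

text \<open>\<open>\<epsilon> \<otimes> id\<^sub>Y : H \<otimes> Y \<rightarrow> K \<otimes> Y = Y\<close>.\<close>

definition counit_tensor_id ::
    "('k, 'p) ring_scheme \<Rightarrow> ('h \<Rightarrow> 'k) \<Rightarrow> ('k, 'y, 's) module_scheme \<Rightarrow> ('h \<times> 'y \<Rightarrow>\<^sub>0 int) set \<Rightarrow> 'y"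
  where "counit_tensor_id K \<epsilon> Y t = left_unitor Y (ktensor_map K (ground_algebra K) Y \<epsilon> id t)"

locale left_coaction = H: bialgebra K H \<Delta> \<epsilon> + A: assoc_algebra K A
  for K (structure) and H (structure) and \<Delta> and \<epsilon> and A (structure) +
  fixes \<delta>
  assumes coaction_hom: "\<delta> \<in> algebra_hom K A (tensor_algebra K H A)"
    and coaction_coassoc: "a \<in> carrier A \<Longrightarrow>
      associator K H H A (tensor_algebra K H A)
        (ktensor_map K (tensor_algebra K H H) A \<Delta> id (\<delta> a))
      = ktensor_map K H (tensor_algebra K H A) id \<delta> (\<delta> a)"
    and coaction_counit: "a \<in> carrier A \<Longrightarrow> counit_tensor_id K \<epsilon> A (\<delta> a) = a"


section \<open>The module \<open>H \<otimes> M\<close>\<close>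

text \<open>A module over the \<open>K\<close>-algebra \<open>A\<close>, viewed as a \<open>K\<close>-vector space.\<close>

definition scalar_module ::
    "('k, 'a, 'q) module_scheme \<Rightarrow> ('a, 'm, 's) module_scheme \<Rightarrow> ('k, 'm) module"
  where "scalar_module A M =
    \<lparr>carrier = carrier M, monoid.mult = monoid.mult M, one = \<one>\<^bsub>M\<^esub>,
     ring.zero = \<zero>\<^bsub>M\<^esub>, ring.add = ring.add M,
     smult = (\<lambda>c m. (c \<odot>\<^bsub>A\<^esub> \<one>\<^bsub>A\<^esub>) \<odot>\<^bsub>M\<^esub> m)\<rparr>"

text \<open>\<open>H \<otimes> M\<close> as a left \<open>H \<otimes> A\<close>-module, \<open>(h \<otimes> a)(h' \<otimes> m) = h h' \<otimes> a m\<close>.\<close>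

definition tensor_module ::
    "('k, 'p) ring_scheme \<Rightarrow> ('k, 'h, 'q) module_scheme \<Rightarrow> ('k, 'a, 's) module_scheme
      \<Rightarrow> ('a, 'm, 't) module_scheme
      \<Rightarrow> (('h \<times> 'a \<Rightarrow>\<^sub>0 int) set, ('h \<times> 'm \<Rightarrow>\<^sub>0 int) set) module"
  where "tensor_module K H A M =
    (let T = ktensor_group K H (scalar_module A M) in
     \<lparr>carrier = carrier T, monoid.mult = undefined, one = undefined,
      ring.zero = \<one>\<^bsub>T\<^esub>, ring.add = monoid.mult T,
      smult = (\<lambda>s t. tensor_lift T (\<lambda>h a.
                 tensor_lift T (\<lambda>h' m.
                   ktensor_elem K H (scalar_module A M) (h \<otimes>\<^bsub>H\<^esub> h') (a \<odot>\<^bsub>M\<^esub> m)) t) s)\<rparr>)"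


section \<open>The map \<open>(\<epsilon> \<otimes> id\<^sub>A)\<^sup>* \<Theta> : M \<rightarrow> M\<close>\<close>

text \<open>The natural map \<open>\<delta>\<^sup>* M \<rightarrow> M\<close> over \<open>\<epsilon> \<otimes> id\<^sub>A\<close>, \<open>t \<otimes> m \<mapsto> (\<epsilon> \<otimes> id\<^sub>A)(t) m\<close>.\<close>

definition coaction_natural ::
    "('k, 'p) ring_scheme \<Rightarrow> ('h \<Rightarrow> 'k) \<Rightarrow> ('k, 'a, 's) module_scheme \<Rightarrow> ('a, 'm, 't) module_scheme
      \<Rightarrow> (('h \<times> 'a \<Rightarrow>\<^sub>0 int) set \<times> 'm \<Rightarrow>\<^sub>0 int) set \<Rightarrow> 'm"
  where "coaction_natural K \<epsilon> A M =
    tensor_lift (add_monoid M) (\<lambda>t m. counit_tensor_id K \<epsilon> A t \<odot>\<^bsub>M\<^esub> m)"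

text \<open>The identifications \<open>(\<epsilon> \<otimes> id\<^sub>A)\<^sup>* (H \<otimes> M) = M\<close> and \<open>(\<epsilon> \<otimes> id\<^sub>A)\<^sup>* \<delta>\<^sup>* M = M\<close> are the
  \<open>A\<close>-module homomorphisms corresponding to the natural maps \<open>H \<otimes> M \<rightarrow> M\<close>, \<open>h \<otimes> m \<mapsto> \<epsilon>(h) m\<close>,
  and \<open>\<delta>\<^sup>* M \<rightarrow> M\<close>.\<close>

definition unit_identification ::
    "('k, 'p) ring_scheme \<Rightarrow> ('h \<Rightarrow> 'k) \<Rightarrow> ('k, 'a, 's) module_scheme \<Rightarrow> ('a, 'm, 't) module_scheme
      \<Rightarrow> ('a \<times> ('h \<times> 'm \<Rightarrow>\<^sub>0 int) set \<Rightarrow>\<^sub>0 int) set \<Rightarrow> 'm"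
  where "unit_identification K \<epsilon> A M =
    ext_adjunct M (counit_tensor_id K \<epsilon> (scalar_module A M))"

definition coaction_identification ::
    "('k, 'p) ring_scheme \<Rightarrow> ('h \<Rightarrow> 'k) \<Rightarrow> ('k, 'a, 's) module_scheme \<Rightarrow> ('a, 'm, 't) module_scheme
      \<Rightarrow> ('a \<times> (('h \<times> 'a \<Rightarrow>\<^sub>0 int) set \<times> 'm \<Rightarrow>\<^sub>0 int) set \<Rightarrow>\<^sub>0 int) set \<Rightarrow> 'm"
  where "coaction_identification K \<epsilon> A M = ext_adjunct M (coaction_natural K \<epsilon> A M)"

definition counit_pullback ::
    "('k, 'p) ring_scheme \<Rightarrow> ('k, 'h, 'q) module_scheme \<Rightarrow> ('h \<Rightarrow> 'k) \<Rightarrow> ('k, 'a, 's) module_scheme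
      \<Rightarrow> ('a \<Rightarrow> ('h \<times> 'a \<Rightarrow>\<^sub>0 int) set) \<Rightarrow> ('a, 'm, 't) module_scheme
      \<Rightarrow> (('h \<times> 'm \<Rightarrow>\<^sub>0 int) set \<Rightarrow> (('h \<times> 'a \<Rightarrow>\<^sub>0 int) set \<times> 'm \<Rightarrow>\<^sub>0 int) set) \<Rightarrow> 'm \<Rightarrow> 'm"
  where "counit_pullback K H \<epsilon> A \<delta> M \<Theta> m =
    (let HA = tensor_algebra K H A; \<phi> = counit_tensor_id K \<epsilon> A in
     coaction_identification K \<epsilon> A M
       (ext_map HA A \<phi> (ext_module A HA \<delta> M) \<Theta>
         (inv_into (carrier (ext_module HA A \<phi> (tensor_module K H A M)))
            (unit_identification K \<epsilon> A M) m)))"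

end

theory Submission
  imports Defs
begin

text \<open>Let \<open>\<pi> : H \<otimes> M \<rightarrow> M\<close> and \<open>\<rho> : \<delta>\<^sup>* M \<rightarrow> M\<close> be the natural maps over \<open>\<epsilon> \<otimes> id\<^sub>A\<close>, and
  \<open>P = (\<epsilon> \<otimes> id\<^sub>A)\<^sup>* \<Theta>\<close>.  The identity \<open>a \<otimes> n = 1 \<otimes> (1 \<otimes> a \<pi>(n))\<close> in \<open>(\<epsilon> \<otimes> id\<^sub>A)\<^sup>* (H \<otimes> M)\<close> shows
  that \<open>P(m) = \<rho>(\<Theta>(1 \<otimes> m))\<close>, and linearity of \<open>\<Theta>\<close> gives \<open>\<rho> \<circ> \<Theta> = P \<circ> \<pi>\<close>.  Evaluated at
  \<open>\<Theta>\<^sup>-\<^sup>1(1 \<otimes> m)\<close> the latter says that the map \<open>(\<epsilon> \<otimes> id) \<circ> \<delta>bar\<close> is a right inverse of \<open>P\<close>.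
  Hence \<open>P\<close> is the identity iff its right inverse is.\<close>

section \<open>Universal property of the tensor product\<close>

text \<open>Both products may be taken over the union of the two supports, since the extra factors
  have exponent zero. Over this common index set additivity is the law of exponents, factor by
  factor. The evaluation map is the one that \<open>tensor_lift\<close> applies to the
  representatives of a coset.\<close>

lemma (in comm_group) hom_frag_evaluation:
  assumes f: "f \<in> S \<rightarrow> carrier G"
  shows "(\<lambda>p. \<Otimes>z\<in>Poly_Mapping.keys p. f z [^] Poly_Mapping.lookup p z)
    \<in> hom (free_Abelian_group S) G" (is "?h \<in> _")
proof (rule homI)
  have carr: "(\<lambda>z. f z [^] (n z :: int)) \<in> B \<rightarrow> carrier G" if "B \<subseteq> S" for n B
    using f that by auto
  have ext: "?h p = (\<Otimes>z\<in>B. f z [^] Poly_Mapping.lookup p z)"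
    if "finite B" "Poly_Mapping.keys p \<subseteq> B" "B \<subseteq> S" for p B
    using that by (intro finprod_mono_neutral_cong_left carr) (auto simp: in_keys_iff)
  fix p assume "p \<in> carrier (free_Abelian_group S)"
  then have p: "Poly_Mapping.keys p \<subseteq> S" by simp
  show "?h p \<in> carrier G"
    by (rule finprod_closed) (rule carr[OF p])
  fix q assume "q \<in> carrier (free_Abelian_group S)"
  then have q: "Poly_Mapping.keys q \<subseteq> S" by simp
  let ?B = "Poly_Mapping.keys p \<union> Poly_Mapping.keys q"
  have B: "finite ?B" "?B \<subseteq> S" "Poly_Mapping.keys (p + q) \<subseteq> ?B"
    using p q keys_add[of p q] by auto
  have "?h (p + q) = (\<Otimes>z\<in>?B. f z [^] Poly_Mapping.lookup p z \<otimes> f z [^] Poly_Mapping.lookup q z)"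
    unfolding ext[OF B(1,3,2)] using f B(2)
    by (intro finprod_cong') (auto simp: lookup_add int_pow_mult Pi_iff)
  also have "\<dots> = (\<Otimes>z\<in>?B. f z [^] Poly_Mapping.lookup p z) \<otimes> (\<Otimes>z\<in>?B. f z [^] Poly_Mapping.lookup q z)"
    by (intro finprod_multf carr B)
  also have "\<dots> = ?h p \<otimes> ?h q"
    using B by (simp add: ext[of ?B])
  finally show "?h (p \<otimes>\<^bsub>free_Abelian_group S\<^esub> q) = ?h p \<otimes> ?h q"
    by simp
qed

text \<open>Besides closure there is one clause for each family in \<open>tensor_relations\<close>,
  so these are the maps whose additive extension kills the relations. The target is written
  multiplicatively, like \<open>tensor_group\<close>; an additive target enters through its
  \<open>add_monoid\<close>.\<close>

definition balanced ::
    "('r, 'p) ring_scheme \<Rightarrow> ('x, 'q) ring_scheme \<Rightarrow> ('x \<Rightarrow> 'r \<Rightarrow> 'x) \<Rightarrow> ('r, 'y, 's) module_scheme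
      \<Rightarrow> ('g, 't) monoid_scheme \<Rightarrow> ('x \<Rightarrow> 'y \<Rightarrow> 'g) \<Rightarrow> bool"
  where "balanced R X r Y G f \<longleftrightarrow>
    (\<forall>x\<in>carrier X. \<forall>y\<in>carrier Y. f x y \<in> carrier G) \<and>
    (\<forall>x\<in>carrier X. \<forall>x'\<in>carrier X. \<forall>y\<in>carrier Y. f (x \<oplus>\<^bsub>X\<^esub> x') y = f x y \<otimes>\<^bsub>G\<^esub> f x' y) \<and>
    (\<forall>x\<in>carrier X. \<forall>y\<in>carrier Y. \<forall>y'\<in>carrier Y. f x (y \<oplus>\<^bsub>Y\<^esub> y') = f x y \<otimes>\<^bsub>G\<^esub> f x y') \<and>
    (\<forall>x\<in>carrier X. \<forall>c\<in>carrier R. \<forall>y\<in>carrier Y. f (r x c) y = f x (c \<odot>\<^bsub>Y\<^esub> y))"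

lemma balancedI:
  assumes "\<And>x y. x \<in> carrier X \<Longrightarrow> y \<in> carrier Y \<Longrightarrow> f x y \<in> carrier G"
    and "\<And>x x' y. x \<in> carrier X \<Longrightarrow> x' \<in> carrier X \<Longrightarrow> y \<in> carrier Y \<Longrightarrow>
      f (x \<oplus>\<^bsub>X\<^esub> x') y = f x y \<otimes>\<^bsub>G\<^esub> f x' y"
    and "\<And>x y y'. x \<in> carrier X \<Longrightarrow> y \<in> carrier Y \<Longrightarrow> y' \<in> carrier Y \<Longrightarrow>
      f x (y \<oplus>\<^bsub>Y\<^esub> y') = f x y \<otimes>\<^bsub>G\<^esub> f x y'"
    and "\<And>x c y. x \<in> carrier X \<Longrightarrow> c \<in> carrier R \<Longrightarrow> y \<in> carrier Y \<Longrightarrow>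
      f (r x c) y = f x (c \<odot>\<^bsub>Y\<^esub> y)"
  shows "balanced R X r Y G f"
  using assms unfolding balanced_def by blast

lemma balancedD:
  assumes "balanced R X r Y G f"
  shows "x \<in> carrier X \<Longrightarrow> y \<in> carrier Y \<Longrightarrow> f x y \<in> carrier G"
    and "x \<in> carrier X \<Longrightarrow> x' \<in> carrier X \<Longrightarrow> y \<in> carrier Y \<Longrightarrow>
      f (x \<oplus>\<^bsub>X\<^esub> x') y = f x y \<otimes>\<^bsub>G\<^esub> f x' y"
    and "x \<in> carrier X \<Longrightarrow> y \<in> carrier Y \<Longrightarrow> y' \<in> carrier Y \<Longrightarrow>
      f x (y \<oplus>\<^bsub>Y\<^esub> y') = f x y \<otimes>\<^bsub>G\<^esub> f x y'"
    and "x \<in> carrier X \<Longrightarrow> c \<in> carrier R \<Longrightarrow> y \<in> carrier Y \<Longrightarrow>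
      f (r x c) y = f x (c \<odot>\<^bsub>Y\<^esub> y)"
  using assms unfolding balanced_def by blast+

lemma tensor_relationsE [consumes 1, case_names add_left add_right act]:
  assumes "z \<in> tensor_relations R X r Y"
  obtains
    x x' y where "z = frag_of (x \<oplus>\<^bsub>X\<^esub> x', y) - frag_of (x, y) - frag_of (x', y)"
      "x \<in> carrier X" "x' \<in> carrier X" "y \<in> carrier Y"
  | x y y' where "z = frag_of (x, y \<oplus>\<^bsub>Y\<^esub> y') - frag_of (x, y) - frag_of (x, y')"
      "x \<in> carrier X" "y \<in> carrier Y" "y' \<in> carrier Y"
  | x c y where "z = frag_of (r x c, y) - frag_of (x, c \<odot>\<^bsub>Y\<^esub> y)"
      "x \<in> carrier X" "c \<in> carrier R" "y \<in> carrier Y"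
  using assms unfolding tensor_relations_def by blast

lemma free_Abelian_group_diff_closed:
  "\<lbrakk>p \<in> carrier (free_Abelian_group S); q \<in> carrier (free_Abelian_group S)\<rbrakk> \<Longrightarrow>
    p - q \<in> carrier (free_Abelian_group S)"
  by (simp, meson Un_least keys_diff order_trans)

text \<open>The relations are written with the subtraction of formal sums, whereas a homomorphism
  speaks of the group operation and the inverse. This translates between the two.\<close>

lemma hom_free_Abelian_group_diff:
  assumes G: "group G" and h: "h \<in> hom (free_Abelian_group S) G"
    and p: "p \<in> carrier (free_Abelian_group S)" and q: "q \<in> carrier (free_Abelian_group S)"
  shows "h (p - q) = h p \<otimes>\<^bsub>G\<^esub> inv\<^bsub>G\<^esub> h q"
proof -
  interpret group_hom "free_Abelian_group S" G h
    using G h by (simp add: group_hom_def group_hom_axioms_def)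
  have "h (p \<otimes>\<^bsub>free_Abelian_group S\<^esub> inv\<^bsub>free_Abelian_group S\<^esub> q) = h p \<otimes>\<^bsub>G\<^esub> inv\<^bsub>G\<^esub> h q"
    using p q by (simp del: mult_free_Abelian_group inv_free_Abelian_group carrier_free_Abelian_group_iff)
  then show ?thesis using q by simp
qed

text \<open>Closure under these four operations places the relations inside the free group. The
  quotient is then an abelian group with the universal property proved below, both over the ground
  ring (\<open>ktensor\<close>) and for extension of scalars
  (\<open>scalar_extension\<close>).\<close>

locale tensor_product =
  fixes R :: "('r, 'p) ring_scheme" and X :: "('x, 'q) ring_scheme" and r :: "'x \<Rightarrow> 'r \<Rightarrow> 'x"
    and Y :: "('r, 'y, 's) module_scheme"
  assumes left_add_closed: "\<lbrakk>x \<in> carrier X; x' \<in> carrier X\<rbrakk> \<Longrightarrow> x \<oplus>\<^bsub>X\<^esub> x' \<in> carrier X"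
    and right_add_closed: "\<lbrakk>y \<in> carrier Y; y' \<in> carrier Y\<rbrakk> \<Longrightarrow> y \<oplus>\<^bsub>Y\<^esub> y' \<in> carrier Y"
    and left_act_closed: "\<lbrakk>x \<in> carrier X; c \<in> carrier R\<rbrakk> \<Longrightarrow> r x c \<in> carrier X"
    and right_act_closed: "\<lbrakk>c \<in> carrier R; y \<in> carrier Y\<rbrakk> \<Longrightarrow> c \<odot>\<^bsub>Y\<^esub> y \<in> carrier Y"
begin

abbreviation F where "F \<equiv> free_Abelian_group (carrier X \<times> carrier Y)"
abbreviation N where "N \<equiv> tensor_kernel R X r Y"
abbreviation T where "T \<equiv> tensor_group R X r Y"
abbreviation elem where "elem \<equiv> tensor_elem R X r Y"

lemma relations_subset: "tensor_relations R X r Y \<subseteq> carrier F"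
proof -
  have "z \<in> carrier F" if z: "z \<in> tensor_relations R X r Y" for z
    using z
    by (cases rule: tensor_relationsE)
      (simp_all add: free_Abelian_group_diff_closed left_add_closed right_add_closed left_act_closed right_act_closed
        del: carrier_free_Abelian_group_iff)
  then show ?thesis by blast
qed

lemma kernel_normal: "N \<lhd> F"
  using group.generate_is_subgroup[OF group_free_Abelian_group relations_subset]
  by (simp add: tensor_kernel_def comm_group.subgroup_imp_normal[OF abelian_free_Abelian_group])

lemma comm_group_tensor_group: "comm_group T"
  unfolding tensor_group_def
  using comm_group.abelian_FactGroup[OF abelian_free_Abelian_group]
    comm_group.normal_iff_subgroup[OF abelian_free_Abelian_group] kernel_normal by blast

sublocale T: comm_group T
  by (rule comm_group_tensor_group)

lemma coset_hom: "(\<lambda>p. N #>\<^bsub>F\<^esub> p) \<in> hom F T"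
  unfolding tensor_group_def by (rule normal.r_coset_hom_Mod[OF kernel_normal])

lemma elem_closed: "\<lbrakk>x \<in> carrier X; y \<in> carrier Y\<rbrakk> \<Longrightarrow> elem x y \<in> carrier T"
  unfolding tensor_elem_def using hom_in_carrier[OF coset_hom] by simp

lemma coset_relation:
  assumes "z \<in> tensor_relations R X r Y"
  shows "N #>\<^bsub>F\<^esub> z = \<one>\<^bsub>T\<^esub>"
proof -
  have "z \<in> N"
    unfolding tensor_kernel_def by (rule generate.incl[OF assms])
  moreover have "subgroup N F"
    using kernel_normal by (simp add: normal_def)
  ultimately have "N #>\<^bsub>F\<^esub> z = N"
    by (metis group.coset_join2 group_free_Abelian_group subgroup.mem_carrier)
  then show ?thesis
    by (simp add: tensor_group_def)
qed

lemma coset_diff: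
  assumes "p \<in> carrier F" "q \<in> carrier F"
  shows "N #>\<^bsub>F\<^esub> (p - q) = (N #>\<^bsub>F\<^esub> p) \<otimes>\<^bsub>T\<^esub> inv\<^bsub>T\<^esub> (N #>\<^bsub>F\<^esub> q)"
  by (rule hom_free_Abelian_group_diff[OF T.is_group coset_hom assms])

lemma balanced_elem: "balanced R X r Y T elem"
proof (rule balancedI)
  \<comment> \<open>\<open>two\<close> and \<open>three\<close> turn a trivial coset back into an
    equation, for relations with two and with three generators respectively.\<close>
  have two: "a = b" if "a \<otimes>\<^bsub>T\<^esub> inv\<^bsub>T\<^esub> b = \<one>\<^bsub>T\<^esub>" "a \<in> carrier T" "b \<in> carrier T" for a b
    using that by (metis T.inv_closed T.inv_equality T.inv_inv)
  have three: "a = b \<otimes>\<^bsub>T\<^esub> c"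
    if "a \<otimes>\<^bsub>T\<^esub> inv\<^bsub>T\<^esub> b \<otimes>\<^bsub>T\<^esub> inv\<^bsub>T\<^esub> c = \<one>\<^bsub>T\<^esub>" "a \<in> carrier T" "b \<in> carrier T" "c \<in> carrier T" for a b c
    using that two[of a "b \<otimes>\<^bsub>T\<^esub> c"] by (simp add: T.inv_mult T.m_assoc)
  show "elem (x \<oplus>\<^bsub>X\<^esub> x') y = elem x y \<otimes>\<^bsub>T\<^esub> elem x' y"
    if "x \<in> carrier X" "x' \<in> carrier X" "y \<in> carrier Y" for x x' y
  proof -
    have "frag_of (x \<oplus>\<^bsub>X\<^esub> x', y) - frag_of (x, y) - frag_of (x', y) \<in> tensor_relations R X r Y"
      using that unfolding tensor_relations_def by blast
    from coset_relation[OF this] show ?thesis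
      using that by (intro three)
        (simp_all add: elem_closed left_add_closed,
          simp add: coset_diff free_Abelian_group_diff_closed tensor_elem_def left_add_closed
            del: carrier_free_Abelian_group_iff)
  qed
  show "elem x (y \<oplus>\<^bsub>Y\<^esub> y') = elem x y \<otimes>\<^bsub>T\<^esub> elem x y'"
    if "x \<in> carrier X" "y \<in> carrier Y" "y' \<in> carrier Y" for x y y'
  proof -
    have "frag_of (x, y \<oplus>\<^bsub>Y\<^esub> y') - frag_of (x, y) - frag_of (x, y') \<in> tensor_relations R X r Y"
      using that unfolding tensor_relations_def by blast
    from coset_relation[OF this] show ?thesis
      using that by (intro three)
        (simp_all add: elem_closed right_add_closed,
          simp add: coset_diff free_Abelian_group_diff_closed tensor_elem_def right_add_closed
            del: carrier_free_Abelian_group_iff)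
  qed
  show "elem (r x c) y = elem x (c \<odot>\<^bsub>Y\<^esub> y)"
    if "x \<in> carrier X" "c \<in> carrier R" "y \<in> carrier Y" for x c y
  proof -
    have "frag_of (r x c, y) - frag_of (x, c \<odot>\<^bsub>Y\<^esub> y) \<in> tensor_relations R X r Y"
      using that unfolding tensor_relations_def by blast
    from coset_relation[OF this] show ?thesis
      using that by - (rule two,
        simp_all add: elem_closed left_act_closed right_act_closed,
        simp_all add: coset_diff tensor_elem_def left_act_closed right_act_closed
          del: carrier_free_Abelian_group_iff)
  qed
qed (rule elem_closed)

text \<open>Pure tensors generate, being the cosets of the free generators; the induction on the
  free group extends the agreement through differences. Almost every later identity is proved by
  this principle: show that both sides are additive, then compare them on pure tensors.\<close>

lemma hom_eqI:
  assumes G: "group G" and f: "f \<in> hom T G" and g: "g \<in> hom T G"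
    and eq: "\<And>x y. x \<in> carrier X \<Longrightarrow> y \<in> carrier Y \<Longrightarrow> f (elem x y) = g (elem x y)"
    and t: "t \<in> carrier T"
  shows "f t = g t"
proof -
  obtain p where p: "p \<in> carrier F" "t = N #>\<^bsub>F\<^esub> p"
    using t by (auto simp: tensor_group_def carrier_FactGroup)
  have hf: "(\<lambda>p. f (N #>\<^bsub>F\<^esub> p)) \<in> hom F G" and hg: "(\<lambda>p. g (N #>\<^bsub>F\<^esub> p)) \<in> hom F G"
    using hom_compose[OF coset_hom f] hom_compose[OF coset_hom g] by (simp_all add: o_def)
  from p(1) have "Poly_Mapping.keys p \<subseteq> carrier X \<times> carrier Y" by simp
  then have "f (N #>\<^bsub>F\<^esub> p) = g (N #>\<^bsub>F\<^esub> p)"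
  proof (rule free_Abelian_group_induct[where P = "\<lambda>p. f (N #>\<^bsub>F\<^esub> p) = g (N #>\<^bsub>F\<^esub> p)"])
    show "f (N #>\<^bsub>F\<^esub> 0) = g (N #>\<^bsub>F\<^esub> 0)"
      using hom_one[OF hf group_free_Abelian_group G] hom_one[OF hg group_free_Abelian_group G]
      by simp
  next
    fix p q :: "'x \<times> 'y \<Rightarrow>\<^sub>0 int"
    assume "Poly_Mapping.keys p \<subseteq> carrier X \<times> carrier Y" "Poly_Mapping.keys q \<subseteq> carrier X \<times> carrier Y"
      "f (N #>\<^bsub>F\<^esub> p) = g (N #>\<^bsub>F\<^esub> p)" "f (N #>\<^bsub>F\<^esub> q) = g (N #>\<^bsub>F\<^esub> q)"
    then show "f (N #>\<^bsub>F\<^esub> (p - q)) = g (N #>\<^bsub>F\<^esub> (p - q))"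
      using hom_free_Abelian_group_diff[OF G hf, of p q] hom_free_Abelian_group_diff[OF G hg, of p q] by simp
  next
    fix z assume "z \<in> carrier X \<times> carrier Y"
    then show "f (N #>\<^bsub>F\<^esub> frag_of z) = g (N #>\<^bsub>F\<^esub> frag_of z)"
      using eq[of "fst z" "snd z"] by (auto simp: tensor_elem_def)
  qed
  with p(2) show ?thesis by simp
qed

text \<open>The universal property. The additive extension \<open>h\<close> of a balanced
  \<open>f\<close> kills each relation, hence the subgroup they generate, so it is constant on every
  coset and \<open>tensor_lift\<close> reads off its value there.\<close>

lemma
  assumes G: "comm_group G" and f: "balanced R X r Y G f"
  shows lift_hom: "tensor_lift G f \<in> hom T G"
    and lift_elem: "\<lbrakk>x \<in> carrier X; y \<in> carrier Y\<rbrakk> \<Longrightarrow> tensor_lift G f (elem x y) = f x y"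
proof -
  interpret G: comm_group G by (rule G)
  let ?f = "\<lambda>z. f (fst z) (snd z)"
  define h where
    "h = (\<lambda>p :: 'x \<times> 'y \<Rightarrow>\<^sub>0 int. \<Otimes>\<^bsub>G\<^esub>z\<in>Poly_Mapping.keys p. ?f z [^]\<^bsub>G\<^esub> Poly_Mapping.lookup p z)"
  have h: "h \<in> hom F G"
    unfolding h_def by (rule G.hom_frag_evaluation) (auto intro: balancedD(1)[OF f])
  interpret h: group_hom F G h
    using h by (simp add: group_hom_def group_hom_axioms_def)
  have h_of: "h (frag_of (x, y)) = f x y" if "x \<in> carrier X" "y \<in> carrier Y" for x y
    using balancedD(1)[OF f that] that by (simp add: h_def)
  have "tensor_relations R X r Y \<subseteq> kernel F G h"
  proof
    fix z assume z: "z \<in> tensor_relations R X r Y"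
    have cancel: "a \<otimes>\<^bsub>G\<^esub> b \<otimes>\<^bsub>G\<^esub> inv\<^bsub>G\<^esub> a \<otimes>\<^bsub>G\<^esub> inv\<^bsub>G\<^esub> b = \<one>\<^bsub>G\<^esub>"
      if "a \<in> carrier G" "b \<in> carrier G" for a b
      using that G.r_inv[of "a \<otimes>\<^bsub>G\<^esub> b"] by (simp add: G.inv_mult G.m_assoc del: G.r_inv G.Units_r_inv)
    have diff: "h (p - q) = h p \<otimes>\<^bsub>G\<^esub> inv\<^bsub>G\<^esub> h q" if "p \<in> carrier F" "q \<in> carrier F" for p q
      by (rule hom_free_Abelian_group_diff[OF G.is_group h that])
    have "h z = \<one>\<^bsub>G\<^esub>"
      using z
      by (cases rule: tensor_relationsE)
        (simp_all add: diff free_Abelian_group_diff_closed h_of balancedD[OF f] cancel left_add_closed right_add_closed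
          left_act_closed right_act_closed del: carrier_free_Abelian_group_iff)
    then show "z \<in> kernel F G h"
      using relations_subset z by (auto simp: kernel_def simp del: carrier_free_Abelian_group_iff)
  qed
  then have N: "N \<subseteq> kernel F G h"
    unfolding tensor_kernel_def
    by (intro group.generate_subgroup_incl[OF group_free_Abelian_group _ h.subgroup_kernel])
  have lift: "tensor_lift G f (N #>\<^bsub>F\<^esub> p) = h p" if p: "p \<in> carrier F" for p
  proof -
    have n: "h (n \<otimes>\<^bsub>F\<^esub> p) = h p" if "n \<in> N" for n
    proof -
      have "n \<in> carrier F" "h n = \<one>\<^bsub>G\<^esub>"
        using N that by (auto simp: kernel_def)
      then show ?thesis
        using h.hom_mult[of n p] p h.hom_closed[OF p] G.l_one by metis
    qed
    \<comment> \<open>The image of the coset is contained in a singleton; an element of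
      \<open>N\<close> shows that it is not empty, so that \<open>the_elem\<close> returns
      \<open>h p\<close>.\<close>
    obtain n0 where "n0 \<in> N"
      using generate.one unfolding tensor_kernel_def by blast
    moreover have "N #>\<^bsub>F\<^esub> p = (\<lambda>n. n \<otimes>\<^bsub>F\<^esub> p) ` N"
      by (auto simp: r_coset_def)
    ultimately have "h ` (N #>\<^bsub>F\<^esub> p) = {h p}"
      using n by (simp add: image_image image_constant del: mult_free_Abelian_group cong: image_cong_simp)
    then show ?thesis
      unfolding tensor_lift_def h_def[symmetric] by simp
  qed
  show "tensor_lift G f (elem x y) = f x y" if "x \<in> carrier X" "y \<in> carrier Y"
    using that by (simp add: tensor_elem_def lift h_of)
  show "tensor_lift G f \<in> hom T G"
  proof (rule homI)
    fix s assume "s \<in> carrier T"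
    then obtain p where p: "p \<in> carrier F" "s = N #>\<^bsub>F\<^esub> p"
      by (auto simp: tensor_group_def carrier_FactGroup)
    then show "tensor_lift G f s \<in> carrier G"
      by (simp add: lift del: carrier_free_Abelian_group_iff)
    fix t assume "t \<in> carrier T"
    then obtain q where q: "q \<in> carrier F" "t = N #>\<^bsub>F\<^esub> q"
      by (auto simp: tensor_group_def carrier_FactGroup)
    have "s \<otimes>\<^bsub>T\<^esub> t = N #>\<^bsub>F\<^esub> (p \<otimes>\<^bsub>F\<^esub> q)"
      using hom_mult[OF coset_hom p(1) q(1)] p(2) q(2) by simp
    moreover have "p \<otimes>\<^bsub>F\<^esub> q \<in> carrier F"
      using p q by blast
    ultimately show "tensor_lift G f (s \<otimes>\<^bsub>T\<^esub> t) = tensor_lift G f s \<otimes>\<^bsub>G\<^esub> tensor_lift G f t"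
      using p q by (simp add: lift del: mult_free_Abelian_group carrier_free_Abelian_group_iff)
  qed
qed

end

text \<open>Two nested lifts make a biadditive map out of a function of two pairs of variables. For
  fixed \<open>t\<close> the inner lift is balanced in the outer pair, because each clause compares
  homomorphisms in \<open>t\<close> and reduces to \<open>left\<close> on pure tensors. Products and
  actions on tensor products have this form.\<close>

lemma
  assumes "tensor_product R X r Y" and "tensor_product R' X' r' Y'" and G: "comm_group G"
    and right: "\<And>x y. \<lbrakk>x \<in> carrier X; y \<in> carrier Y\<rbrakk> \<Longrightarrow> balanced R' X' r' Y' G (f x y)"
    and left: "\<And>x' y'. \<lbrakk>x' \<in> carrier X'; y' \<in> carrier Y'\<rbrakk> \<Longrightarrow>
      balanced R X r Y G (\<lambda>x y. f x y x' y')"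
  shows lift2_hom_left: "t \<in> carrier (tensor_group R' X' r' Y') \<Longrightarrow>
      (\<lambda>s. tensor_lift G (\<lambda>x y. tensor_lift G (f x y) t) s) \<in> hom (tensor_group R X r Y) G"
    and lift2_hom_right: "s \<in> carrier (tensor_group R X r Y) \<Longrightarrow>
      (\<lambda>t. tensor_lift G (\<lambda>x y. tensor_lift G (f x y) t) s) \<in> hom (tensor_group R' X' r' Y') G"
    and lift2_elem: "\<lbrakk>x \<in> carrier X; y \<in> carrier Y; x' \<in> carrier X'; y' \<in> carrier Y'\<rbrakk> \<Longrightarrow>
      tensor_lift G (\<lambda>x y. tensor_lift G (f x y) (tensor_elem R' X' r' Y' x' y'))
        (tensor_elem R X r Y x y) = f x y x' y'"
proof -
  interpret T1: tensor_product R X r Y by fact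
  interpret T2: tensor_product R' X' r' Y' by fact
  interpret G: comm_group G by (rule G)
  note inner = T2.lift_hom[OF G right] T2.lift_elem[OF G right]
  have closed: "tensor_lift G (f x y) t \<in> carrier G"
    if "x \<in> carrier X" "y \<in> carrier Y" "t \<in> carrier T2.T" for x y t
    using hom_in_carrier[OF inner(1)[OF that(1,2)] that(3)] .
  have bal: "balanced R X r Y G (\<lambda>x y. tensor_lift G (f x y) t)" if t: "t \<in> carrier T2.T" for t
  proof (rule balancedI)
    show "tensor_lift G (f (x \<oplus>\<^bsub>X\<^esub> x') y) t = tensor_lift G (f x y) t \<otimes>\<^bsub>G\<^esub> tensor_lift G (f x' y) t"
      if "x \<in> carrier X" "x' \<in> carrier X" "y \<in> carrier Y" for x x' y
      by (rule T2.hom_eqI[OF G.is_group _ _ _ t])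
        (use that in \<open>auto intro!: inner(1) G.hom_group_mult
          simp: inner(2) T1.left_add_closed balancedD(2)[OF left]\<close>)
    show "tensor_lift G (f x (y \<oplus>\<^bsub>Y\<^esub> y')) t = tensor_lift G (f x y) t \<otimes>\<^bsub>G\<^esub> tensor_lift G (f x y') t"
      if "x \<in> carrier X" "y \<in> carrier Y" "y' \<in> carrier Y" for x y y'
      by (rule T2.hom_eqI[OF G.is_group _ _ _ t])
        (use that in \<open>auto intro!: inner(1) G.hom_group_mult
          simp: inner(2) T1.right_add_closed balancedD(3)[OF left]\<close>)
    show "tensor_lift G (f (r x c) y) t = tensor_lift G (f x (c \<odot>\<^bsub>Y\<^esub> y)) t"
      if "x \<in> carrier X" "c \<in> carrier R" "y \<in> carrier Y" for x c y
      by (rule T2.hom_eqI[OF G.is_group _ _ _ t])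
        (use that in \<open>auto intro!: inner(1)
          simp: inner(2) T1.left_act_closed T1.right_act_closed balancedD(4)[OF left]\<close>)
  qed (rule closed[OF _ _ t])
  note outer = T1.lift_hom[OF G bal] T1.lift_elem[OF G bal]
  show "(\<lambda>s. tensor_lift G (\<lambda>x y. tensor_lift G (f x y) t) s) \<in> hom T1.T G" if "t \<in> carrier T2.T"
    using outer(1)[OF that] .
  show "(\<lambda>t. tensor_lift G (\<lambda>x y. tensor_lift G (f x y) t) s) \<in> hom T2.T G" if s: "s \<in> carrier T1.T"
  proof (rule homI)
    fix t assume t: "t \<in> carrier T2.T"
    show "tensor_lift G (\<lambda>x y. tensor_lift G (f x y) t) s \<in> carrier G"
      by (rule hom_in_carrier[OF outer(1)[OF t] s])
    fix t' assume t': "t' \<in> carrier T2.T"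
    show "tensor_lift G (\<lambda>x y. tensor_lift G (f x y) (t \<otimes>\<^bsub>T2.T\<^esub> t')) s =
      tensor_lift G (\<lambda>x y. tensor_lift G (f x y) t) s \<otimes>\<^bsub>G\<^esub>
      tensor_lift G (\<lambda>x y. tensor_lift G (f x y) t') s"
      \<comment> \<open>Additivity in \<open>t\<close> is transported from pure tensors to arbitrary
        \<open>s\<close>; on pure tensors it is the additivity of the inner lift.\<close>
      by (rule T1.hom_eqI[OF G.is_group _ _ _ s])
        (use t t' in \<open>auto intro!: outer(1) G.hom_group_mult simp: outer(2) hom_mult[OF inner(1)]\<close>)
  qed
  show "tensor_lift G (\<lambda>x y. tensor_lift G (f x y) (T2.elem x' y')) (T1.elem x y) = f x y x' y'"
    if "x \<in> carrier X" "y \<in> carrier Y" "x' \<in> carrier X'" "y' \<in> carrier Y'"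
    using that by (simp add: outer(2) inner(2) T2.elem_closed)
qed

section \<open>Tensor products of modules over a commutative ring\<close>

locale ktensor = X: module K X + Y: module K Y for K (structure) and X and Y
begin

sublocale tensor_product K X "\<lambda>x c. c \<odot>\<^bsub>X\<^esub> x" Y
  rewrites "tensor_group K X (\<lambda>x c. c \<odot>\<^bsub>X\<^esub> x) Y = ktensor_group K X Y"
    and "tensor_elem K X (\<lambda>x c. c \<odot>\<^bsub>X\<^esub> x) Y = ktensor_elem K X Y"
  by unfold_locales (simp_all add: ktensor_group_def ktensor_elem_def)

lemmas elem_add_left = balancedD(2)[OF balanced_elem]
  and elem_add_right = balancedD(3)[OF balanced_elem]
  and elem_act = balancedD(4)[OF balanced_elem]

end

section \<open>The action of \<open>H \<otimes> A\<close> on \<open>H \<otimes> Y\<close> induced by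
  an action of \<open>A\<close> on \<open>Y\<close>\<close>

definition tensor_act ::
    "('k, 'p) ring_scheme \<Rightarrow> ('k, 'h, 'q) module_scheme \<Rightarrow> ('k, 'y, 's) module_scheme
      \<Rightarrow> ('a \<Rightarrow> 'y \<Rightarrow> 'y) \<Rightarrow> ('h \<times> 'a \<Rightarrow>\<^sub>0 int) set \<Rightarrow> ('h \<times> 'y \<Rightarrow>\<^sub>0 int) set \<Rightarrow> ('h \<times> 'y \<Rightarrow>\<^sub>0 int) set"
  where "tensor_act K H Y \<nu> s t =
    tensor_lift (ktensor_group K H Y) (\<lambda>h a.
      tensor_lift (ktensor_group K H Y) (\<lambda>h' y. ktensor_elem K H Y (h \<otimes>\<^bsub>H\<^esub> h') (\<nu> a y)) t) s"

text \<open>The instances are \<open>Y = A\<close>, which yields the multiplication of \<open>H \<otimes> A\<close>, and \<open>Y = M\<close> as a vector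
  space, which yields the action of \<open>H \<otimes> A\<close> on \<open>H \<otimes> M\<close>.\<close>

locale algebra_action = H: assoc_algebra K H + A: assoc_algebra K A + Y: module K Y
  for K (structure) and H and A and Y +
  fixes \<nu> :: "'a \<Rightarrow> 'y \<Rightarrow> 'y"
  assumes \<nu>_closed: "\<lbrakk>a \<in> carrier A; y \<in> carrier Y\<rbrakk> \<Longrightarrow> \<nu> a y \<in> carrier Y"
    and \<nu>_add_left: "\<lbrakk>a \<in> carrier A; a' \<in> carrier A; y \<in> carrier Y\<rbrakk> \<Longrightarrow>
      \<nu> (a \<oplus>\<^bsub>A\<^esub> a') y = \<nu> a y \<oplus>\<^bsub>Y\<^esub> \<nu> a' y"
    and \<nu>_add_right: "\<lbrakk>a \<in> carrier A; y \<in> carrier Y; y' \<in> carrier Y\<rbrakk> \<Longrightarrow>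
      \<nu> a (y \<oplus>\<^bsub>Y\<^esub> y') = \<nu> a y \<oplus>\<^bsub>Y\<^esub> \<nu> a y'"
    and \<nu>_smult_left: "\<lbrakk>c \<in> carrier K; a \<in> carrier A; y \<in> carrier Y\<rbrakk> \<Longrightarrow>
      \<nu> (c \<odot>\<^bsub>A\<^esub> a) y = c \<odot>\<^bsub>Y\<^esub> \<nu> a y"
    and \<nu>_smult_right: "\<lbrakk>c \<in> carrier K; a \<in> carrier A; y \<in> carrier Y\<rbrakk> \<Longrightarrow>
      \<nu> a (c \<odot>\<^bsub>Y\<^esub> y) = c \<odot>\<^bsub>Y\<^esub> \<nu> a y"
    and \<nu>_assoc: "\<lbrakk>a \<in> carrier A; a' \<in> carrier A; y \<in> carrier Y\<rbrakk> \<Longrightarrow>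
      \<nu> (a \<otimes>\<^bsub>A\<^esub> a') y = \<nu> a (\<nu> a' y)"
    and \<nu>_one: "y \<in> carrier Y \<Longrightarrow> \<nu> \<one>\<^bsub>A\<^esub> y = y"
begin

sublocale HA: ktensor K H A ..
sublocale HY: ktensor K H Y ..

lemma act_balanced_right:
  assumes "h \<in> carrier H" "a \<in> carrier A"
  shows "balanced K H (\<lambda>x c. c \<odot>\<^bsub>H\<^esub> x) Y (ktensor_group K H Y)
    (\<lambda>h' y. ktensor_elem K H Y (h \<otimes>\<^bsub>H\<^esub> h') (\<nu> a y))"
  using assms
  by (intro balancedI)
    (simp_all add: HY.elem_closed \<nu>_closed H.r_distr HY.elem_add_left HY.elem_add_right \<nu>_add_right
      H.smult_mult_right HY.elem_act \<nu>_smult_right)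

lemma act_balanced_left:
  assumes "h' \<in> carrier H" "y \<in> carrier Y"
  shows "balanced K H (\<lambda>x c. c \<odot>\<^bsub>H\<^esub> x) A (ktensor_group K H Y)
    (\<lambda>h a. ktensor_elem K H Y (h \<otimes>\<^bsub>H\<^esub> h') (\<nu> a y))"
  using assms
  by (intro balancedI)
    (simp_all add: HY.elem_closed \<nu>_closed H.l_distr HY.elem_add_left HY.elem_add_right \<nu>_add_left
      H.smult_mult_left HY.elem_act \<nu>_smult_left)

lemmas act_facts = HA.tensor_product_axioms HY.tensor_product_axioms HY.comm_group_tensor_group
  act_balanced_right act_balanced_left

lemma act_hom_left:
  "t \<in> carrier (ktensor_group K H Y) \<Longrightarrow>
    (\<lambda>s. tensor_act K H Y \<nu> s t) \<in> hom (ktensor_group K H A) (ktensor_group K H Y)"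
  using lift2_hom_left[OF act_facts] unfolding tensor_act_def ktensor_group_def by simp

lemma act_hom_right:
  "s \<in> carrier (ktensor_group K H A) \<Longrightarrow>
    (\<lambda>t. tensor_act K H Y \<nu> s t) \<in> hom (ktensor_group K H Y) (ktensor_group K H Y)"
  using lift2_hom_right[OF act_facts] unfolding tensor_act_def ktensor_group_def by simp

lemma act_elem:
  "\<lbrakk>h \<in> carrier H; a \<in> carrier A; h' \<in> carrier H; y \<in> carrier Y\<rbrakk> \<Longrightarrow>
    tensor_act K H Y \<nu> (ktensor_elem K H A h a) (ktensor_elem K H Y h' y) =
    ktensor_elem K H Y (h \<otimes>\<^bsub>H\<^esub> h') (\<nu> a y)"
  using lift2_elem[OF act_facts] unfolding tensor_act_def ktensor_group_def ktensor_elem_def by simp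

lemma act_closed:
  "\<lbrakk>s \<in> carrier (ktensor_group K H A); t \<in> carrier (ktensor_group K H Y)\<rbrakk> \<Longrightarrow>
    tensor_act K H Y \<nu> s t \<in> carrier (ktensor_group K H Y)"
  by (rule hom_in_carrier[OF act_hom_left])

lemma act_one:
  assumes t: "t \<in> carrier (ktensor_group K H Y)"
  shows "tensor_act K H Y \<nu> (ktensor_elem K H A \<one>\<^bsub>H\<^esub> \<one>\<^bsub>A\<^esub>) t = t"
proof (rule HY.hom_eqI[OF HY.T.is_group _ _ _ t])
  show "(\<lambda>t. t) \<in> hom (ktensor_group K H Y) (ktensor_group K H Y)"
    by (simp add: hom_def)
qed (auto intro!: act_hom_right HA.elem_closed simp: act_elem \<nu>_one)

end

lemma algebra_action_mult:
  assumes "assoc_algebra K H" and "assoc_algebra K A"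
  shows "algebra_action K H A A (monoid.mult A)"
proof -
  interpret H: assoc_algebra K H by fact
  interpret A: assoc_algebra K A by fact
  show ?thesis
    by unfold_locales (simp_all add: A.l_distr A.r_distr A.smult_mult_left A.smult_mult_right A.m_assoc)
qed

context algebra_action
begin

text \<open>Both sides are additive in each of \<open>s\<close>, \<open>t\<close> and
  \<open>u\<close>, so three nested reductions lead to pure tensors, where associativity in
  \<open>H\<close> and \<open>\<nu>_assoc\<close> finish. The product of \<open>s\<close> and
  \<open>t\<close> is itself such an action, that of \<open>A\<close> on itself, which
  \<open>AA\<close> provides.\<close>

lemma act_assoc:
  assumes s: "s \<in> carrier (ktensor_group K H A)" and t: "t \<in> carrier (ktensor_group K H A)"
    and u: "u \<in> carrier (ktensor_group K H Y)"
  shows "tensor_act K H Y \<nu> (tensor_act K H A (monoid.mult A) s t) u =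
    tensor_act K H Y \<nu> s (tensor_act K H Y \<nu> t u)"
proof -
  interpret AA: algebra_action K H A A "monoid.mult A"
    by (rule algebra_action_mult[OF H.assoc_algebra_axioms A.assoc_algebra_axioms])
  note G = HY.T.is_group
  show ?thesis
  proof (rule HA.hom_eqI[OF G _ _ _ s])
    show "(\<lambda>s. tensor_act K H Y \<nu> (tensor_act K H A (monoid.mult A) s t) u)
        \<in> hom (ktensor_group K H A) (ktensor_group K H Y)"
      using hom_compose[OF AA.act_hom_left[OF t] act_hom_left[OF u]] by (simp add: o_def)
    show "(\<lambda>s. tensor_act K H Y \<nu> s (tensor_act K H Y \<nu> t u))
        \<in> hom (ktensor_group K H A) (ktensor_group K H Y)"
      by (intro act_hom_left act_closed t u)
    fix h a assume ha: "h \<in> carrier H" "a \<in> carrier A"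
    note s' = HA.elem_closed[OF ha]
    show "tensor_act K H Y \<nu> (tensor_act K H A (monoid.mult A) (ktensor_elem K H A h a) t) u =
        tensor_act K H Y \<nu> (ktensor_elem K H A h a) (tensor_act K H Y \<nu> t u)"
    proof (rule HA.hom_eqI[OF G _ _ _ t])
      show "(\<lambda>t. tensor_act K H Y \<nu> (tensor_act K H A (monoid.mult A) (ktensor_elem K H A h a) t) u)
          \<in> hom (ktensor_group K H A) (ktensor_group K H Y)"
        using hom_compose[OF AA.act_hom_right[OF s'] act_hom_left[OF u]] by (simp add: o_def)
      show "(\<lambda>t. tensor_act K H Y \<nu> (ktensor_elem K H A h a) (tensor_act K H Y \<nu> t u))
          \<in> hom (ktensor_group K H A) (ktensor_group K H Y)"
        using hom_compose[OF act_hom_left[OF u] act_hom_right[OF s']] by (simp add: o_def)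
      fix h' a' assume ha': "h' \<in> carrier H" "a' \<in> carrier A"
      note t' = HA.elem_closed[OF ha']
      show "tensor_act K H Y \<nu>
          (tensor_act K H A (monoid.mult A) (ktensor_elem K H A h a) (ktensor_elem K H A h' a')) u =
          tensor_act K H Y \<nu> (ktensor_elem K H A h a)
            (tensor_act K H Y \<nu> (ktensor_elem K H A h' a') u)"
      proof (rule HY.hom_eqI[OF G _ _ _ u])
        show "(\<lambda>u. tensor_act K H Y \<nu> (ktensor_elem K H A h a)
              (tensor_act K H Y \<nu> (ktensor_elem K H A h' a') u))
            \<in> hom (ktensor_group K H Y) (ktensor_group K H Y)"
          using hom_compose[OF act_hom_right[OF t'] act_hom_right[OF s']] by (simp add: o_def)
      qed (use ha ha' s' t' in \<open>auto intro!: act_hom_right HA.elem_closed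
          simp: act_elem AA.act_elem \<nu>_closed H.m_assoc \<nu>_assoc\<close>)
    qed
  qed
qed

end

text \<open>The algebras and modules below copy the operation of a commutative group into the
  additive fields of a record. This carries the group laws over, whatever the remaining fields
  contain.\<close>

lemma abelian_group_transfer:
  assumes "comm_group G" and "carrier A = carrier G" and "ring.add A = monoid.mult G"
    and "\<zero>\<^bsub>A\<^esub> = \<one>\<^bsub>G\<^esub>"
  shows "abelian_group A"
proof -
  interpret G: comm_group G by fact
  show ?thesis
    by (rule abelian_groupI)
      (auto simp: assms G.m_ac intro: G.l_inv_ex)
qed

section \<open>The algebra \<open>H \<otimes> A\<close> and the module \<open>H \<otimes> M\<close>\<close>

lemma tensor_algebra_simps:
  "carrier (tensor_algebra K H A) = carrier (ktensor_group K H A)"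
  "monoid.mult (tensor_algebra K H A) = tensor_act K H A (monoid.mult A)"
  "\<one>\<^bsub>tensor_algebra K H A\<^esub> = ktensor_elem K H A \<one>\<^bsub>H\<^esub> \<one>\<^bsub>A\<^esub>"
  "\<zero>\<^bsub>tensor_algebra K H A\<^esub> = \<one>\<^bsub>ktensor_group K H A\<^esub>"
  "ring.add (tensor_algebra K H A) = monoid.mult (ktensor_group K H A)"
  by (simp_all add: tensor_algebra_def Let_def tensor_act_def fun_eq_iff)

lemma tensor_module_simps:
  "carrier (tensor_module K H A M) = carrier (ktensor_group K H (scalar_module A M))"
  "smult (tensor_module K H A M) = tensor_act K H (scalar_module A M) (smult M)"
  "\<zero>\<^bsub>tensor_module K H A M\<^esub> = \<one>\<^bsub>ktensor_group K H (scalar_module A M)\<^esub>"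
  "ring.add (tensor_module K H A M) = monoid.mult (ktensor_group K H (scalar_module A M))"
  by (simp_all add: tensor_module_def Let_def tensor_act_def fun_eq_iff)

lemma ring_tensor_algebra:
  assumes "assoc_algebra K H" and "assoc_algebra K A"
  shows "ring (tensor_algebra K H A)"
proof -
  interpret algebra_action K H A A "monoid.mult A"
    by (rule algebra_action_mult[OF assms])
  show ?thesis
  proof (rule ringI)
    show "abelian_group (tensor_algebra K H A)"
      by (rule abelian_group_transfer[OF HA.comm_group_tensor_group]) (simp_all add: tensor_algebra_simps)
    show "monoid (tensor_algebra K H A)"
    proof (rule monoidI)
      fix t assume t: "t \<in> carrier (tensor_algebra K H A)"
      \<comment> \<open>The other ring laws are instances of the laws of an action, applied to
        \<open>A\<close> acting on itself. The right unit is not among these and is checked on pure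
        tensors.\<close>
      have "tensor_act K H A (monoid.mult A) t (ktensor_elem K H A \<one>\<^bsub>H\<^esub> \<one>\<^bsub>A\<^esub>) = t"
      proof (rule HA.hom_eqI[OF HA.T.is_group])
        show "(\<lambda>t. t) \<in> hom (ktensor_group K H A) (ktensor_group K H A)"
          by (simp add: hom_def)
      qed (use t in \<open>auto intro!: act_hom_left HA.elem_closed simp: act_elem tensor_algebra_simps\<close>)
      then show "t \<otimes>\<^bsub>tensor_algebra K H A\<^esub> \<one>\<^bsub>tensor_algebra K H A\<^esub> = t"
        by (simp add: tensor_algebra_simps)
    qed (simp_all add: tensor_algebra_simps act_closed act_assoc act_one HA.elem_closed)
  qed (simp_all add: tensor_algebra_simps hom_mult[OF act_hom_left] hom_mult[OF act_hom_right])
qed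

lemma left_module_tensor_module:
  assumes "algebra_action K H A (scalar_module A M) (smult M)"
  shows "left_module (tensor_algebra K H A) (tensor_module K H A M)"
proof -
  interpret algebra_action K H A "scalar_module A M" "smult M" by fact
  show ?thesis
  proof (intro left_module.intro left_module_axioms.intro)
    show "ring (tensor_algebra K H A)"
      by (rule ring_tensor_algebra[OF H.assoc_algebra_axioms A.assoc_algebra_axioms])
    show "abelian_group (tensor_module K H A M)"
      by (rule abelian_group_transfer[OF HY.comm_group_tensor_group]) (simp_all add: tensor_module_simps)
  qed (simp_all add: tensor_algebra_simps tensor_module_simps act_closed act_assoc act_one
      hom_mult[OF act_hom_left] hom_mult[OF act_hom_right])
qed

lemma scalar_module_simps:
  "carrier (scalar_module A M) = carrier M"
  "ring.add (scalar_module A M) = ring.add M"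
  "\<zero>\<^bsub>scalar_module A M\<^esub> = \<zero>\<^bsub>M\<^esub>"
  "c \<odot>\<^bsub>scalar_module A M\<^esub> m = (c \<odot>\<^bsub>A\<^esub> \<one>\<^bsub>A\<^esub>) \<odot>\<^bsub>M\<^esub> m"
  by (simp_all add: scalar_module_def)

lemma algebra_action_scalar_module:
  assumes "assoc_algebra K H" and "assoc_algebra K A" and "left_module A M"
  shows "algebra_action K H A (scalar_module A M) (smult M)"
proof -
  interpret H: assoc_algebra K H by fact
  interpret A: assoc_algebra K A by fact
  interpret M: left_module A M by fact
  \<comment> \<open>The elements \<open>c \<odot> 1\<close> are central, and multiplying by one of
    them on either side is scaling by \<open>c\<close>. This makes the action of \<open>A\<close>
    bilinear over \<open>K\<close> when \<open>M\<close> is regarded as a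
    \<open>K\<close>-module.\<close>
  have mult_one: "(c \<odot>\<^bsub>A\<^esub> \<one>\<^bsub>A\<^esub>) \<otimes>\<^bsub>A\<^esub> a = c \<odot>\<^bsub>A\<^esub> a" "a \<otimes>\<^bsub>A\<^esub> (c \<odot>\<^bsub>A\<^esub> \<one>\<^bsub>A\<^esub>) = c \<odot>\<^bsub>A\<^esub> a"
    if "c \<in> carrier K" "a \<in> carrier A" for c a
    using that by (simp_all add: A.smult_mult_left A.smult_mult_right)
  have S: "abelian_group (scalar_module A M)"
    by (rule abelian_group_transfer[OF M.M.a_comm_group]) (simp_all add: scalar_module_simps)
  have "module K (scalar_module A M)"
    by (rule moduleI[OF H.R.is_cring S])
      (simp_all add: scalar_module_simps M.smult_closed A.smult_l_distr M.smult_l_distr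
        M.smult_r_distr M.smult_one mult_one H.R.m_comm flip: A.smult_assoc1 M.smult_assoc)
  then interpret S: module K "scalar_module A M" .
  show ?thesis
    by unfold_locales
      (simp_all add: scalar_module_simps M.smult_closed M.smult_l_distr M.smult_r_distr M.smult_one
        mult_one flip: M.smult_assoc)
qed

section \<open>The counit\<close>

lemma ground_algebra_simps:
  "carrier (ground_algebra K) = carrier K"
  "monoid.mult (ground_algebra K) = monoid.mult K"
  "\<one>\<^bsub>ground_algebra K\<^esub> = \<one>\<^bsub>K\<^esub>"
  "ring.add (ground_algebra K) = ring.add K"
  "\<zero>\<^bsub>ground_algebra K\<^esub> = \<zero>\<^bsub>K\<^esub>"
  "smult (ground_algebra K) = monoid.mult K"
  by (simp_all add: ground_algebra_def)

lemma module_ground_algebra: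
  assumes "cring K"
  shows "module K (ground_algebra K)"
proof -
  interpret cring K by fact
  have "abelian_group (ground_algebra K)"
    by (rule abelian_group_transfer[OF a_comm_group]) (simp_all add: ground_algebra_simps)
  then show ?thesis
    by (intro moduleI) (simp_all add: ground_algebra_simps is_cring l_distr r_distr m_assoc)
qed

context bialgebra
begin

lemma counit_closed: "h \<in> carrier H \<Longrightarrow> \<epsilon> h \<in> carrier K"
  and counit_add: "\<lbrakk>h \<in> carrier H; h' \<in> carrier H\<rbrakk> \<Longrightarrow> \<epsilon> (h \<oplus>\<^bsub>H\<^esub> h') = \<epsilon> h \<oplus>\<^bsub>K\<^esub> \<epsilon> h'"
  and counit_mult: "\<lbrakk>h \<in> carrier H; h' \<in> carrier H\<rbrakk> \<Longrightarrow> \<epsilon> (h \<otimes>\<^bsub>H\<^esub> h') = \<epsilon> h \<otimes>\<^bsub>K\<^esub> \<epsilon> h'"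
  and counit_one: "\<epsilon> \<one>\<^bsub>H\<^esub> = \<one>\<^bsub>K\<^esub>"
  and counit_smult: "\<lbrakk>c \<in> carrier K; h \<in> carrier H\<rbrakk> \<Longrightarrow> \<epsilon> (c \<odot>\<^bsub>H\<^esub> h) = c \<otimes>\<^bsub>K\<^esub> \<epsilon> h"
  using counit_hom unfolding algebra_hom_def ring_hom_def
  by (auto simp: ground_algebra_simps)

lemma
  assumes "module K Y"
  shows counit_tensor_id_hom: "counit_tensor_id K \<epsilon> Y \<in> hom (ktensor_group K H Y) (add_monoid Y)"
    and counit_tensor_id_elem: "\<lbrakk>h \<in> carrier H; y \<in> carrier Y\<rbrakk> \<Longrightarrow>
      counit_tensor_id K \<epsilon> Y (ktensor_elem K H Y h y) = \<epsilon> h \<odot>\<^bsub>Y\<^esub> y"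
proof -
  interpret Y: module K Y by fact
  interpret G: module K "ground_algebra K"
    by (rule module_ground_algebra[OF R.is_cring])
  interpret HY: ktensor K H Y ..
  interpret GY: ktensor K "ground_algebra K" Y ..
  have bal1: "balanced K H (\<lambda>x c. c \<odot>\<^bsub>H\<^esub> x) Y (ktensor_group K (ground_algebra K) Y)
      (\<lambda>x y. ktensor_elem K (ground_algebra K) Y (\<epsilon> x) (id y))"
    using GY.elem_closed GY.elem_add_left GY.elem_add_right GY.elem_act
    by (intro balancedI) (simp_all add: counit_closed counit_add counit_smult ground_algebra_simps)
  \<comment> \<open>Commutativity of \<open>K\<close> enters here: the right action on the ground
    algebra is multiplication from the left, so \<open>(c x) y\<close> has to be compared with
    \<open>x (c y)\<close>.\<close>
  have bal2: "balanced K (ground_algebra K) (\<lambda>x c. c \<odot>\<^bsub>ground_algebra K\<^esub> x) Y (add_monoid Y)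
      (\<lambda>c y. c \<odot>\<^bsub>Y\<^esub> y)"
    by (intro balancedI)
      (simp_all add: ground_algebra_simps Y.smult_l_distr Y.smult_r_distr R.m_comm flip: Y.smult_assoc1)
  note map = HY.lift_hom[OF GY.comm_group_tensor_group bal1]
    HY.lift_elem[OF GY.comm_group_tensor_group bal1]
  note unitor = GY.lift_hom[OF Y.a_comm_group bal2] GY.lift_elem[OF Y.a_comm_group bal2]
  show "counit_tensor_id K \<epsilon> Y \<in> hom (ktensor_group K H Y) (add_monoid Y)"
    using hom_compose[OF map(1) unitor(1)]
    by (simp add: counit_tensor_id_def[abs_def] left_unitor_def ktensor_map_def o_def)
  show "counit_tensor_id K \<epsilon> Y (ktensor_elem K H Y h y) = \<epsilon> h \<odot>\<^bsub>Y\<^esub> y"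
    if "h \<in> carrier H" "y \<in> carrier Y"
    using that map(2) unitor(2)
    by (simp add: counit_tensor_id_def left_unitor_def ktensor_map_def counit_closed ground_algebra_simps)
qed

text \<open>On pure tensors this is the multiplicativity of \<open>\<epsilon>\<close> together with
  the bilinearity of \<open>\<nu>\<close>; both sides are additive in \<open>s\<close> and in
  \<open>t\<close>. For \<open>Y = A\<close> it makes \<open>\<epsilon> \<otimes> id\<close>
  multiplicative, and for \<open>Y = M\<close> it makes \<open>H \<otimes> M \<rightarrow> M\<close>
  linear over that map.\<close>

lemma counit_tensor_id_act:
  assumes "algebra_action K H A Y \<nu>"
    and s: "s \<in> carrier (ktensor_group K H A)" and t: "t \<in> carrier (ktensor_group K H Y)"
  shows "counit_tensor_id K \<epsilon> Y (tensor_act K H Y \<nu> s t) =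
    \<nu> (counit_tensor_id K \<epsilon> A s) (counit_tensor_id K \<epsilon> Y t)"
proof -
  interpret algebra_action K H A Y \<nu> by fact
  note eY = counit_tensor_id_hom[OF Y.module_axioms] counit_tensor_id_elem[OF Y.module_axioms]
  note eA = counit_tensor_id_hom[OF A.module_axioms] counit_tensor_id_elem[OF A.module_axioms]
  have \<nu>_hom_left: "(\<lambda>a. \<nu> a y) \<in> hom (add_monoid A) (add_monoid Y)" if "y \<in> carrier Y" for y
    using that by (auto simp: hom_def \<nu>_closed \<nu>_add_left)
  have \<nu>_hom_right: "\<nu> a \<in> hom (add_monoid Y) (add_monoid Y)" if "a \<in> carrier A" for a
    using that by (auto simp: hom_def \<nu>_closed \<nu>_add_right)
  note G = Y.a_group
  have t': "counit_tensor_id K \<epsilon> Y t \<in> carrier Y"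
    using hom_in_carrier[OF eY(1) t] by simp
  show ?thesis
  proof (rule HA.hom_eqI[OF G _ _ _ s])
    show "(\<lambda>s. counit_tensor_id K \<epsilon> Y (tensor_act K H Y \<nu> s t))
        \<in> hom (ktensor_group K H A) (add_monoid Y)"
      using hom_compose[OF act_hom_left[OF t] eY(1)] by (simp add: o_def)
    show "(\<lambda>s. \<nu> (counit_tensor_id K \<epsilon> A s) (counit_tensor_id K \<epsilon> Y t))
        \<in> hom (ktensor_group K H A) (add_monoid Y)"
      using hom_compose[OF eA(1) \<nu>_hom_left[OF t']] by (simp add: o_def)
    fix h a assume ha: "h \<in> carrier H" "a \<in> carrier A"
    note s' = HA.elem_closed[OF ha]
    have ca: "counit_tensor_id K \<epsilon> A (ktensor_elem K H A h a) \<in> carrier A"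
      using hom_in_carrier[OF eA(1) s'] by simp
    show "counit_tensor_id K \<epsilon> Y (tensor_act K H Y \<nu> (ktensor_elem K H A h a) t) =
        \<nu> (counit_tensor_id K \<epsilon> A (ktensor_elem K H A h a)) (counit_tensor_id K \<epsilon> Y t)"
    proof (rule HY.hom_eqI[OF G _ _ _ t])
      show "(\<lambda>t. counit_tensor_id K \<epsilon> Y (tensor_act K H Y \<nu> (ktensor_elem K H A h a) t))
          \<in> hom (ktensor_group K H Y) (add_monoid Y)"
        using hom_compose[OF act_hom_right[OF s'] eY(1)] by (simp add: o_def)
      show "(\<lambda>t. \<nu> (counit_tensor_id K \<epsilon> A (ktensor_elem K H A h a)) (counit_tensor_id K \<epsilon> Y t))
          \<in> hom (ktensor_group K H Y) (add_monoid Y)"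
        using hom_compose[OF eY(1) \<nu>_hom_right[OF ca]] by (simp add: o_def)
    qed (use ha in \<open>simp add: act_elem eY(2) eA(2) \<nu>_closed counit_closed counit_mult
        \<nu>_smult_left \<nu>_smult_right R.m_comm flip: Y.smult_assoc1\<close>)
  qed
qed

end

section \<open>Extension of scalars\<close>

locale scalar_extension = B: ring B + left_module A M
  for A and B and \<phi> and M +
  assumes \<phi>_hom: "\<phi> \<in> ring_hom A B"
begin

abbreviation E where "E \<equiv> ext_module A B \<phi> M"

sublocale tensor_product A B "\<lambda>b a. b \<otimes>\<^bsub>B\<^esub> \<phi> a" M
  rewrites "tensor_elem A B (\<lambda>b a. b \<otimes>\<^bsub>B\<^esub> \<phi> a) M = ext_elem A B \<phi> M"
  by unfold_locales (simp_all add: ext_elem_def smult_closed ring_hom_closed[OF \<phi>_hom])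

lemma ext_module_simps:
  "carrier E = carrier T"
  "ring.add E = monoid.mult T"
  "\<zero>\<^bsub>E\<^esub> = \<one>\<^bsub>T\<^esub>"
  "smult E b = tensor_lift T (\<lambda>b' m. ext_elem A B \<phi> M (b \<otimes>\<^bsub>B\<^esub> b') m)"
  by (simp_all add: ext_module_def Let_def)

text \<open>\<open>E\<close> and \<open>T\<close> are different records over the same group.
  Equating their sets of homomorphisms lets the facts about tensor groups be restated for
  \<open>E\<close>.\<close>

lemma hom_ext_module:
  "hom (add_monoid E) G = hom T G" "hom G (add_monoid E) = hom G T"
  by (simp_all add: hom_def ext_module_simps)

lemma abelian_group_ext_module: "abelian_group E"
  by (rule abelian_group_transfer[OF comm_group_tensor_group]) (simp_all add: ext_module_simps)

lemmas ext_lift_hom = lift_hom[folded hom_ext_module]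
  and ext_hom_eqI = hom_eqI[folded hom_ext_module ext_module_simps(1)]
  and ext_elem_closed = elem_closed[folded ext_module_simps(1)]
  and ext_elem_add_left = balancedD(2)[OF balanced_elem, folded ext_module_simps(2)]
  and ext_elem_add_right = balancedD(3)[OF balanced_elem, folded ext_module_simps(2)]
  and ext_elem_act = balancedD(4)[OF balanced_elem]

text \<open>By associativity in \<open>B\<close>, multiplication by \<open>b\<close> from the left
  commutes with the right action of \<open>A\<close> through \<open>\<phi>\<close>. Hence it
  respects the relations and descends to the tensor product.\<close>

lemma
  assumes b: "b \<in> carrier B"
  shows ext_smult_hom: "smult E b \<in> hom (add_monoid E) (add_monoid E)"
    and ext_smult_elem: "\<lbrakk>b' \<in> carrier B; m \<in> carrier M\<rbrakk> \<Longrightarrow>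
      b \<odot>\<^bsub>E\<^esub> ext_elem A B \<phi> M b' m = ext_elem A B \<phi> M (b \<otimes>\<^bsub>B\<^esub> b') m"
proof -
  have bal: "balanced A B (\<lambda>b a. b \<otimes>\<^bsub>B\<^esub> \<phi> a) M T (\<lambda>b' m. ext_elem A B \<phi> M (b \<otimes>\<^bsub>B\<^esub> b') m)"
    using b by (intro balancedI)
      (simp_all add: elem_closed B.r_distr balancedD(2,3)[OF balanced_elem] ring_hom_closed[OF \<phi>_hom]
        flip: ext_elem_act B.m_assoc)
  show "smult E b \<in> hom (add_monoid E) (add_monoid E)"
    unfolding hom_ext_module ext_module_simps(4) by (rule lift_hom[OF comm_group_tensor_group bal])
  show "b \<odot>\<^bsub>E\<^esub> ext_elem A B \<phi> M b' m = ext_elem A B \<phi> M (b \<otimes>\<^bsub>B\<^esub> b') m"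
    if "b' \<in> carrier B" "m \<in> carrier M"
    unfolding ext_module_simps(4) using that by (rule lift_elem[OF comm_group_tensor_group bal])
qed

lemma left_module_ext_module: "left_module B E"
proof (intro left_module.intro left_module_axioms.intro)
  interpret E: abelian_group E by (rule abelian_group_ext_module)
  note G = E.a_group
  show "ring B" ..
  show "abelian_group E" ..
  show closed: "b \<odot>\<^bsub>E\<^esub> x \<in> carrier E" if "b \<in> carrier B" "x \<in> carrier E" for b x
    using hom_in_carrier[OF ext_smult_hom[OF that(1)]] that(2) by simp
  show "b \<odot>\<^bsub>E\<^esub> (x \<oplus>\<^bsub>E\<^esub> y) = b \<odot>\<^bsub>E\<^esub> x \<oplus>\<^bsub>E\<^esub> b \<odot>\<^bsub>E\<^esub> y"
    if "b \<in> carrier B" "x \<in> carrier E" "y \<in> carrier E" for b x y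
    using hom_mult[OF ext_smult_hom[OF that(1)]] that(2,3) by simp
  show "(b \<oplus>\<^bsub>B\<^esub> b') \<odot>\<^bsub>E\<^esub> x = b \<odot>\<^bsub>E\<^esub> x \<oplus>\<^bsub>E\<^esub> b' \<odot>\<^bsub>E\<^esub> x"
    if b: "b \<in> carrier B" "b' \<in> carrier B" and x: "x \<in> carrier E" for b b' x
  proof (rule ext_hom_eqI[OF G _ _ _ x])
    show "(\<lambda>x. b \<odot>\<^bsub>E\<^esub> x \<oplus>\<^bsub>E\<^esub> b' \<odot>\<^bsub>E\<^esub> x) \<in> hom (add_monoid E) (add_monoid E)"
      using comm_group.hom_group_mult[OF E.a_comm_group ext_smult_hom[OF b(1)] ext_smult_hom[OF b(2)]]
      by simp
  qed (use b in \<open>simp_all add: ext_smult_hom ext_smult_elem B.l_distr ext_elem_add_left\<close>)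
  show "(b \<otimes>\<^bsub>B\<^esub> b') \<odot>\<^bsub>E\<^esub> x = b \<odot>\<^bsub>E\<^esub> (b' \<odot>\<^bsub>E\<^esub> x)"
    if b: "b \<in> carrier B" "b' \<in> carrier B" and x: "x \<in> carrier E" for b b' x
  proof (rule ext_hom_eqI[OF G _ _ _ x])
    show "(\<lambda>x. b \<odot>\<^bsub>E\<^esub> (b' \<odot>\<^bsub>E\<^esub> x)) \<in> hom (add_monoid E) (add_monoid E)"
      using hom_compose[OF ext_smult_hom[OF b(2)] ext_smult_hom[OF b(1)]] by (simp add: o_def)
  qed (use b in \<open>simp_all add: ext_smult_hom ext_smult_elem B.m_assoc\<close>)
  show "\<one>\<^bsub>B\<^esub> \<odot>\<^bsub>E\<^esub> x = x" if x: "x \<in> carrier E" for x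
  proof (rule ext_hom_eqI[OF G _ _ _ x])
    show "(\<lambda>x. x) \<in> hom (add_monoid E) (add_monoid E)"
      by (simp add: hom_def)
  qed (simp_all add: ext_smult_hom ext_smult_elem)
qed

end

section \<open>Pulling back along the counit\<close>

locale coaction_module = left_coaction K H \<Delta> \<epsilon> A \<delta> + M: left_module A M
  for K (structure) and H and \<Delta> and \<epsilon> and A and \<delta> and M
begin

abbreviation HA where "HA \<equiv> tensor_algebra K H A"
abbreviation S where "S \<equiv> scalar_module A M"
abbreviation HM where "HM \<equiv> tensor_module K H A M"
abbreviation D where "D \<equiv> ext_module A HA \<delta> M"
abbreviation \<phi> where "\<phi> \<equiv> counit_tensor_id K \<epsilon> A"
abbreviation \<pi> where "\<pi> \<equiv> counit_tensor_id K \<epsilon> S"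
abbreviation \<rho> where "\<rho> \<equiv> coaction_natural K \<epsilon> A M"

sublocale HM: algebra_action K H A S "smult M"
  by (rule algebra_action_scalar_module[OF H.assoc_algebra_axioms A.assoc_algebra_axioms M.left_module_axioms])

sublocale HA: ring HA
  by (rule ring_tensor_algebra[OF H.assoc_algebra_axioms A.assoc_algebra_axioms])

sublocale HM: left_module HA HM
  by (rule left_module_tensor_module[OF HM.algebra_action_axioms])

sublocale D: scalar_extension A HA \<delta> M
  using coaction_hom by unfold_locales (simp add: algebra_hom_def)

sublocale D: left_module HA D
  by (rule D.left_module_ext_module)

section \<open>The natural maps \<open>\<pi>\<close> and \<open>\<rho>\<close> to \<open>M\<close>
  and their linearity over \<open>\<phi>\<close>\<close>

lemma hom_HM: "hom (add_monoid HM) G = hom (ktensor_group K H S) G"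
  "hom G (add_monoid HM) = hom G (ktensor_group K H S)"
  by (simp_all add: hom_def tensor_module_simps)

lemma \<phi>_hom: "\<phi> \<in> hom (add_monoid HA) (add_monoid A)"
  using H.counit_tensor_id_hom[OF A.module_axioms] by (simp add: hom_def tensor_algebra_simps)

lemma \<phi>_closed: "s \<in> carrier HA \<Longrightarrow> \<phi> s \<in> carrier A"
  using hom_in_carrier[OF \<phi>_hom] by simp

lemma \<phi>_add: "\<lbrakk>s \<in> carrier HA; t \<in> carrier HA\<rbrakk> \<Longrightarrow> \<phi> (s \<oplus>\<^bsub>HA\<^esub> t) = \<phi> s \<oplus>\<^bsub>A\<^esub> \<phi> t"
  using hom_mult[OF \<phi>_hom] by simp

lemma \<phi>_elem: "\<lbrakk>h \<in> carrier H; a \<in> carrier A\<rbrakk> \<Longrightarrow> \<phi> (ktensor_elem K H A h a) = \<epsilon> h \<odot>\<^bsub>A\<^esub> a"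
  by (rule H.counit_tensor_id_elem[OF A.module_axioms])

lemma \<phi>_mult: "\<lbrakk>s \<in> carrier HA; t \<in> carrier HA\<rbrakk> \<Longrightarrow> \<phi> (s \<otimes>\<^bsub>HA\<^esub> t) = \<phi> s \<otimes>\<^bsub>A\<^esub> \<phi> t"
  using H.counit_tensor_id_act[OF algebra_action_mult[OF H.assoc_algebra_axioms A.assoc_algebra_axioms]]
  by (simp add: tensor_algebra_simps)

lemma \<phi>_one: "\<phi> \<one>\<^bsub>HA\<^esub> = \<one>\<^bsub>A\<^esub>"
  by (simp add: tensor_algebra_simps \<phi>_elem H.counit_one)

lemma \<phi>_ring_hom: "\<phi> \<in> ring_hom HA A"
  by (rule ring_hom_memI) (simp_all add: \<phi>_closed \<phi>_mult \<phi>_add \<phi>_one)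

sublocale EHM: scalar_extension HA A \<phi> HM
  by unfold_locales (rule \<phi>_ring_hom)

sublocale ED: scalar_extension HA A \<phi> D
  by unfold_locales (rule \<phi>_ring_hom)

lemma \<delta>_closed: "a \<in> carrier A \<Longrightarrow> \<delta> a \<in> carrier HA"
  using ring_hom_closed[OF D.\<phi>_hom] .

lemma \<pi>_hom: "\<pi> \<in> hom (add_monoid HM) (add_monoid M)"
  using H.counit_tensor_id_hom[OF HM.Y.module_axioms]
  by (simp add: hom_def tensor_module_simps scalar_module_simps)

lemma \<pi>_closed: "x \<in> carrier HM \<Longrightarrow> \<pi> x \<in> carrier M"
  using hom_in_carrier[OF \<pi>_hom] by simp

lemma \<pi>_add: "\<lbrakk>x \<in> carrier HM; y \<in> carrier HM\<rbrakk> \<Longrightarrow> \<pi> (x \<oplus>\<^bsub>HM\<^esub> y) = \<pi> x \<oplus>\<^bsub>M\<^esub> \<pi> y"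
  using hom_mult[OF \<pi>_hom] by simp

lemma \<pi>_elem: "\<lbrakk>h \<in> carrier H; m \<in> carrier M\<rbrakk> \<Longrightarrow>
    \<pi> (ktensor_elem K H S h m) = (\<epsilon> h \<odot>\<^bsub>A\<^esub> \<one>\<^bsub>A\<^esub>) \<odot>\<^bsub>M\<^esub> m"
  using H.counit_tensor_id_elem[OF HM.Y.module_axioms] by (simp add: scalar_module_simps)

lemma \<pi>_smult: "\<lbrakk>s \<in> carrier HA; x \<in> carrier HM\<rbrakk> \<Longrightarrow> \<pi> (s \<odot>\<^bsub>HM\<^esub> x) = \<phi> s \<odot>\<^bsub>M\<^esub> \<pi> x"
  using H.counit_tensor_id_act[OF HM.algebra_action_axioms]
  by (simp add: tensor_algebra_simps tensor_module_simps)

text \<open>The counit law of the coaction enters here: \<open>a\<close> acts on \<open>HA\<close>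
  from the right as \<open>\<delta> a\<close>, and \<open>\<phi> (\<delta> a) = a\<close> turns this
  into the action of \<open>a\<close> on \<open>M\<close>.\<close>

lemma coaction_natural_balanced:
  "balanced A HA (\<lambda>b a. b \<otimes>\<^bsub>HA\<^esub> \<delta> a) M (add_monoid M) (\<lambda>t m. \<phi> t \<odot>\<^bsub>M\<^esub> m)"
  by (intro balancedI)
    (simp_all add: \<phi>_closed \<phi>_add \<phi>_mult \<delta>_closed coaction_counit
      M.smult_closed M.smult_l_distr M.smult_r_distr M.smult_assoc)

lemma \<rho>_hom: "\<rho> \<in> hom (add_monoid D) (add_monoid M)"
  using D.ext_lift_hom[OF M.M.a_comm_group coaction_natural_balanced]
  by (simp add: coaction_natural_def[abs_def])

lemma \<rho>_elem: "\<lbrakk>t \<in> carrier HA; m \<in> carrier M\<rbrakk> \<Longrightarrow> \<rho> (ext_elem A HA \<delta> M t m) = \<phi> t \<odot>\<^bsub>M\<^esub> m"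
  using D.lift_elem[OF M.M.a_comm_group coaction_natural_balanced]
  by (simp add: coaction_natural_def)

lemma \<rho>_closed: "x \<in> carrier D \<Longrightarrow> \<rho> x \<in> carrier M"
  using hom_in_carrier[OF \<rho>_hom] by simp

lemma \<rho>_add: "\<lbrakk>x \<in> carrier D; y \<in> carrier D\<rbrakk> \<Longrightarrow> \<rho> (x \<oplus>\<^bsub>D\<^esub> y) = \<rho> x \<oplus>\<^bsub>M\<^esub> \<rho> y"
  using hom_mult[OF \<rho>_hom] by simp

lemma smult_hom: "a \<in> carrier A \<Longrightarrow> smult M a \<in> hom (add_monoid M) (add_monoid M)"
  by (auto simp: hom_def M.smult_closed M.smult_r_distr)

text \<open>On \<open>t \<otimes> m\<close> this is the multiplicativity of \<open>\<phi>\<close>.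
  It is also what makes \<open>coaction_identification\<close> balanced.\<close>

lemma \<rho>_smult:
  assumes s: "s \<in> carrier HA" and x: "x \<in> carrier D"
  shows "\<rho> (s \<odot>\<^bsub>D\<^esub> x) = \<phi> s \<odot>\<^bsub>M\<^esub> \<rho> x"
proof (rule D.ext_hom_eqI[OF M.M.a_group _ _ _ x])
  show "(\<lambda>x. \<rho> (s \<odot>\<^bsub>D\<^esub> x)) \<in> hom (add_monoid D) (add_monoid M)"
    using hom_compose[OF D.ext_smult_hom[OF s] \<rho>_hom] by (simp add: o_def)
  show "(\<lambda>x. \<phi> s \<odot>\<^bsub>M\<^esub> \<rho> x) \<in> hom (add_monoid D) (add_monoid M)"
    using hom_compose[OF \<rho>_hom smult_hom[OF \<phi>_closed[OF s]]] by (simp add: o_def)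
qed (use s in \<open>simp add: D.ext_smult_elem \<rho>_elem \<phi>_mult \<phi>_closed M.smult_assoc\<close>)

lemma \<rho>_natural: "m \<in> carrier M \<Longrightarrow> \<rho> (ext_natural A HA \<delta> M m) = m"
  by (simp add: ext_natural_def \<rho>_elem \<phi>_one M.smult_one)

text \<open>The natural map from \<open>M\<close> to its extension along
  \<open>\<eta> \<otimes> id\<close>. It is a section of \<open>\<pi>\<close>, and its image
  generates \<open>HM\<close> over \<open>HA\<close>, since \<open>h \<otimes> m\<close> is
  \<open>h \<otimes> 1\<close> applied to \<open>\<iota> m\<close>.\<close>

abbreviation \<iota> where "\<iota> m \<equiv> ktensor_elem K H S \<one>\<^bsub>H\<^esub> m"

lemma \<iota>_closed: "m \<in> carrier M \<Longrightarrow> \<iota> m \<in> carrier HM"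
  using HM.HY.elem_closed by (simp add: tensor_module_simps scalar_module_simps)

lemma \<pi>_\<iota>: "m \<in> carrier M \<Longrightarrow> \<pi> (\<iota> m) = m"
  by (simp add: \<pi>_elem H.counit_one M.smult_one)

lemma \<iota>_smult:
  "\<lbrakk>h \<in> carrier H; a \<in> carrier A; m \<in> carrier M\<rbrakk> \<Longrightarrow>
    ktensor_elem K H A h a \<odot>\<^bsub>HM\<^esub> \<iota> m = ktensor_elem K H S h (a \<odot>\<^bsub>M\<^esub> m)"
  using HM.act_elem by (simp add: tensor_module_simps scalar_module_simps)

lemma \<iota>_add: "\<lbrakk>m \<in> carrier M; m' \<in> carrier M\<rbrakk> \<Longrightarrow> \<iota> (m \<oplus>\<^bsub>M\<^esub> m') = \<iota> m \<oplus>\<^bsub>HM\<^esub> \<iota> m'"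
  using HM.HY.elem_add_right by (simp add: tensor_module_simps scalar_module_simps)

lemma HA_elem_closed: "\<lbrakk>h \<in> carrier H; a \<in> carrier A\<rbrakk> \<Longrightarrow> ktensor_elem K H A h a \<in> carrier HA"
  using HM.HA.elem_closed by (simp add: tensor_algebra_simps)

lemma HM_hom_eqI:
  assumes "group G" "f \<in> hom (add_monoid HM) G" "g \<in> hom (add_monoid HM) G"
    and "\<And>h m. \<lbrakk>h \<in> carrier H; m \<in> carrier M\<rbrakk> \<Longrightarrow>
      f (ktensor_elem K H S h m) = g (ktensor_elem K H S h m)"
    and "x \<in> carrier HM"
  shows "f x = g x"
  by (rule HM.HY.hom_eqI[OF assms(1-3)[unfolded hom_HM]])
    (use assms(4,5) in \<open>simp_all add: tensor_module_simps scalar_module_simps\<close>)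

section \<open>The two identifications with \<open>M\<close>, and the inverse of the first\<close>

lemma unit_identification_balanced:
  "balanced HA A (\<lambda>b a. b \<otimes>\<^bsub>A\<^esub> \<phi> a) HM (add_monoid M) (\<lambda>a x. a \<odot>\<^bsub>M\<^esub> \<pi> x)"
  by (intro balancedI)
    (simp_all add: \<pi>_closed \<pi>_add \<pi>_smult \<phi>_closed
      M.smult_closed M.smult_l_distr M.smult_r_distr M.smult_assoc)

lemma coaction_identification_balanced:
  "balanced HA A (\<lambda>b a. b \<otimes>\<^bsub>A\<^esub> \<phi> a) D (add_monoid M) (\<lambda>a x. a \<odot>\<^bsub>M\<^esub> \<rho> x)"
  by (intro balancedI)
    (simp_all add: \<rho>_closed \<rho>_add \<rho>_smult \<phi>_closed
      M.smult_closed M.smult_l_distr M.smult_r_distr M.smult_assoc)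

lemma unit_identification_hom:
  "unit_identification K \<epsilon> A M \<in> hom (add_monoid (ext_module HA A \<phi> HM)) (add_monoid M)"
  using EHM.ext_lift_hom[OF M.M.a_comm_group unit_identification_balanced]
  by (simp add: unit_identification_def ext_adjunct_def)

lemma unit_identification_elem:
  "\<lbrakk>a \<in> carrier A; x \<in> carrier HM\<rbrakk> \<Longrightarrow>
    unit_identification K \<epsilon> A M (ext_elem HA A \<phi> HM a x) = a \<odot>\<^bsub>M\<^esub> \<pi> x"
  using EHM.lift_elem[OF M.M.a_comm_group unit_identification_balanced]
  by (simp add: unit_identification_def ext_adjunct_def)

lemma coaction_identification_elem:
  "\<lbrakk>a \<in> carrier A; x \<in> carrier D\<rbrakk> \<Longrightarrow>
    coaction_identification K \<epsilon> A M (ext_elem HA A \<phi> D a x) = a \<odot>\<^bsub>M\<^esub> \<rho> x"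
  using ED.lift_elem[OF M.M.a_comm_group coaction_identification_balanced]
  by (simp add: coaction_identification_def ext_adjunct_def)

lemma unit_section_hom:
  "(\<lambda>m. ext_elem HA A \<phi> HM \<one>\<^bsub>A\<^esub> (\<iota> m)) \<in> hom (add_monoid M) (add_monoid (ext_module HA A \<phi> HM))"
  by (auto simp: hom_def \<iota>_closed \<iota>_add EHM.ext_elem_closed EHM.ext_elem_add_right)

text \<open>The candidate inverse sends \<open>m\<close> to
  \<open>1 \<otimes> (1 \<otimes> m)\<close>. That it is a left inverse makes
  \<open>unit_identification\<close> injective, which gives the \<open>inv_into\<close> in
  \<open>counit_pullback\<close> an explicit value.\<close>

lemma unit_section:
  assumes x: "x \<in> carrier (ext_module HA A \<phi> HM)"
  shows "ext_elem HA A \<phi> HM \<one>\<^bsub>A\<^esub> (\<iota> (unit_identification K \<epsilon> A M x)) = x"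
proof -
  interpret E: abelian_group "ext_module HA A \<phi> HM"
    by (rule EHM.abelian_group_ext_module)
  note G = E.a_group
  let ?e = "ext_elem HA A \<phi> HM"
  let ?E = "ext_module HA A \<phi> HM"
  show ?thesis
  proof (rule EHM.ext_hom_eqI[OF G _ _ _ x])
    show "(\<lambda>x. ?e \<one>\<^bsub>A\<^esub> (\<iota> (unit_identification K \<epsilon> A M x))) \<in> hom (add_monoid ?E) (add_monoid ?E)"
      using hom_compose[OF unit_identification_hom unit_section_hom] by (simp add: o_def)
    show "(\<lambda>x. x) \<in> hom (add_monoid ?E) (add_monoid ?E)"
      by (simp add: hom_def)
    fix a y assume a: "a \<in> carrier A" and y: "y \<in> carrier HM"
    have "?e \<one>\<^bsub>A\<^esub> (\<iota> (a \<odot>\<^bsub>M\<^esub> \<pi> y)) = ?e a y"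
    proof (rule HM_hom_eqI[OF G _ _ _ y])
      show "(\<lambda>y. ?e \<one>\<^bsub>A\<^esub> (\<iota> (a \<odot>\<^bsub>M\<^esub> \<pi> y))) \<in> hom (add_monoid HM) (add_monoid ?E)"
        using hom_compose[OF hom_compose[OF \<pi>_hom smult_hom[OF a]] unit_section_hom]
        by (simp add: o_def)
      show "?e a \<in> hom (add_monoid HM) (add_monoid ?E)"
        using a by (auto simp: hom_def EHM.ext_elem_closed EHM.ext_elem_add_right)
      fix h m assume h: "h \<in> carrier H" and m: "m \<in> carrier M"
      \<comment> \<open>Scalars of \<open>HA\<close> cross the outer tensor sign through
        \<open>\<phi>\<close>. First \<open>?s\<close> moves left, where it merges with
        \<open>a\<close> into \<open>?b\<close>; since \<open>\<phi> ?t = ?b\<close>, the whole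
        factor then moves back to the right as \<open>?t\<close>, leaving \<open>1\<close>
        behind.\<close>
      let ?s = "ktensor_elem K H A h \<one>\<^bsub>A\<^esub>" and ?b = "\<epsilon> h \<odot>\<^bsub>A\<^esub> a"
      let ?t = "ktensor_elem K H A \<one>\<^bsub>H\<^esub> ?b"
      have b: "?b \<in> carrier A" "a \<otimes>\<^bsub>A\<^esub> (\<epsilon> h \<odot>\<^bsub>A\<^esub> \<one>\<^bsub>A\<^esub>) = ?b"
        using a h by (simp_all add: H.counit_closed A.smult_mult_right)
      have "?e a (ktensor_elem K H S h m) = ?e a (?s \<odot>\<^bsub>HM\<^esub> \<iota> m)"
        using h m by (simp add: \<iota>_smult M.smult_one)
      also have "\<dots> = ?e (a \<otimes>\<^bsub>A\<^esub> \<phi> ?s) (\<iota> m)"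
        using a h m by (simp add: EHM.ext_elem_act HA_elem_closed \<iota>_closed)
      also have "\<dots> = ?e (\<one>\<^bsub>A\<^esub> \<otimes>\<^bsub>A\<^esub> \<phi> ?t) (\<iota> m)"
        using h b by (simp add: \<phi>_elem H.counit_one)
      also have "\<dots> = ?e \<one>\<^bsub>A\<^esub> (?t \<odot>\<^bsub>HM\<^esub> \<iota> m)"
        using m b(1) by (intro EHM.ext_elem_act) (simp_all add: HA_elem_closed \<iota>_closed)
      also have "?t \<odot>\<^bsub>HM\<^esub> \<iota> m = \<iota> (a \<odot>\<^bsub>M\<^esub> \<pi> (ktensor_elem K H S h m))"
        using a h m b by (simp add: \<iota>_smult \<pi>_elem H.counit_closed flip: M.smult_assoc)
      finally show "?e \<one>\<^bsub>A\<^esub> (\<iota> (a \<odot>\<^bsub>M\<^esub> \<pi> (ktensor_elem K H S h m))) = ?e a (ktensor_elem K H S h m)"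
        by simp
    qed
    then show "?e \<one>\<^bsub>A\<^esub> (\<iota> (unit_identification K \<epsilon> A M (?e a y))) = ?e a y"
      using a y by (simp add: unit_identification_elem)
  qed
qed

section \<open>The pullback of a module homomorphism \<open>\<Theta>\<close>\<close>

context
  fixes \<Theta>
  assumes \<Theta>: "\<Theta> \<in> left_module_hom HA HM D"
begin

lemma \<Theta>_hom: "\<Theta> \<in> hom (add_monoid HM) (add_monoid D)"
  and \<Theta>_smult: "\<lbrakk>s \<in> carrier HA; x \<in> carrier HM\<rbrakk> \<Longrightarrow> \<Theta> (s \<odot>\<^bsub>HM\<^esub> x) = s \<odot>\<^bsub>D\<^esub> \<Theta> x"
  using \<Theta> by (simp_all add: left_module_hom_def)

lemma \<Theta>_closed: "x \<in> carrier HM \<Longrightarrow> \<Theta> x \<in> carrier D"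
  using hom_in_carrier[OF \<Theta>_hom] by simp

text \<open>Follow \<open>m\<close> through the three maps: the inverse identification gives
  \<open>1 \<otimes> \<iota> m\<close>, the extended map gives
  \<open>1 \<otimes> \<Theta> (\<iota> m)\<close>, and the last identification applies
  \<open>\<rho>\<close>.\<close>

lemma counit_pullback_eq:
  assumes m: "m \<in> carrier M"
  shows "counit_pullback K H \<epsilon> A \<delta> M \<Theta> m = \<rho> (\<Theta> (\<iota> m))"
proof -
  let ?u = "unit_identification K \<epsilon> A M" and ?E = "ext_module HA A \<phi> HM"
  let ?x = "ext_elem HA A \<phi> HM \<one>\<^bsub>A\<^esub> (\<iota> m)"
  have x: "?x \<in> carrier ?E" and ux: "?u ?x = m"
    using m by (simp_all add: EHM.ext_elem_closed \<iota>_closed unit_identification_elem \<pi>_\<iota> M.smult_one)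
  have "inj_on ?u (carrier ?E)"
    by (rule inj_on_inverseI[where g = "\<lambda>m. ext_elem HA A \<phi> HM \<one>\<^bsub>A\<^esub> (\<iota> m)"]) (rule unit_section)
  with x ux have inv: "inv_into (carrier ?E) ?u m = ?x"
    by (metis inv_into_f_f)
  \<comment> \<open>The extension of \<open>\<Theta>\<close> is well defined because
    \<open>\<Theta>\<close> is linear over \<open>HA\<close>.\<close>
  have bal: "balanced HA A (\<lambda>b a. b \<otimes>\<^bsub>A\<^esub> \<phi> a) HM (add_monoid (ext_module HA A \<phi> D))
      (\<lambda>a x. ext_elem HA A \<phi> D a (\<Theta> x))"
    using hom_mult[OF \<Theta>_hom]
    by (intro balancedI)
      (simp_all add: ED.ext_elem_closed ED.ext_elem_add_left ED.ext_elem_add_right ED.ext_elem_act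
        \<Theta>_closed \<Theta>_smult)
  have "ext_map HA A \<phi> D \<Theta> ?x = ext_elem HA A \<phi> D \<one>\<^bsub>A\<^esub> (\<Theta> (\<iota> m))"
    unfolding ext_map_def
    using EHM.lift_elem[OF abelian_group.a_comm_group[OF ED.abelian_group_ext_module] bal] m
    by (simp add: \<iota>_closed)
  then show ?thesis
    using m by (simp add: counit_pullback_def inv coaction_identification_elem \<Theta>_closed \<iota>_closed
        \<rho>_closed M.smult_one)
qed

text \<open>In view of \<open>counit_pullback_eq\<close> this says that
  \<open>\<rho> \<circ> \<Theta>\<close> factors through \<open>\<pi>\<close>. The reason is that
  \<open>\<rho> \<circ> \<Theta>\<close> is linear over \<open>\<phi>\<close>, so that it sees the
  factor \<open>h\<close> of \<open>h \<otimes> m\<close> only through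
  \<open>\<epsilon> h\<close>.\<close>

lemma \<rho>_\<Theta>:
  assumes x: "x \<in> carrier HM"
  shows "\<rho> (\<Theta> x) = \<rho> (\<Theta> (\<iota> (\<pi> x)))"
proof (rule HM_hom_eqI[OF M.M.a_group _ _ _ x])
  show \<rho>\<Theta>: "(\<lambda>x. \<rho> (\<Theta> x)) \<in> hom (add_monoid HM) (add_monoid M)"
    using hom_compose[OF \<Theta>_hom \<rho>_hom] by (simp add: o_def)
  have "\<iota> \<in> hom (add_monoid M) (add_monoid HM)"
    by (auto simp: hom_def \<iota>_closed \<iota>_add)
  from hom_compose[OF hom_compose[OF \<pi>_hom this] \<rho>\<Theta>]
  show "(\<lambda>x. \<rho> (\<Theta> (\<iota> (\<pi> x)))) \<in> hom (add_monoid HM) (add_monoid M)"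
    by (simp add: o_def)
  fix h m assume h: "h \<in> carrier H" and m: "m \<in> carrier M"
  \<comment> \<open>\<open>h \<otimes> m\<close> and \<open>1 \<otimes> \<epsilon>(h) m\<close> are multiples of \<open>1 \<otimes> m\<close> by scalars with the same image under \<open>\<phi>\<close>.\<close>
  let ?s = "ktensor_elem K H A h \<one>\<^bsub>A\<^esub>"
  let ?t = "ktensor_elem K H A \<one>\<^bsub>H\<^esub> (\<epsilon> h \<odot>\<^bsub>A\<^esub> \<one>\<^bsub>A\<^esub>)"
  have st: "?s \<in> carrier HA" "?t \<in> carrier HA" "\<phi> ?s = \<phi> ?t"
    using h by (simp_all add: HA_elem_closed \<phi>_elem H.counit_closed H.counit_one)
  have "\<rho> (\<Theta> (?s \<odot>\<^bsub>HM\<^esub> \<iota> m)) = \<rho> (\<Theta> (?t \<odot>\<^bsub>HM\<^esub> \<iota> m))"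
    using st m by (simp add: \<Theta>_smult \<rho>_smult \<iota>_closed \<Theta>_closed)
  then show "\<rho> (\<Theta> (ktensor_elem K H S h m)) = \<rho> (\<Theta> (\<iota> (\<pi> (ktensor_elem K H S h m))))"
    using h m by (simp add: \<iota>_smult \<pi>_elem M.smult_one H.counit_closed)
qed

end

end

theorem corollary2p5:
  fixes K :: "'k ring" and H :: "('k, 'h) module" and A :: "('k, 'a) module"
    and M :: "('a, 'm) module"
    and \<Delta> :: "'h \<Rightarrow> ('h \<times> 'h \<Rightarrow>\<^sub>0 int) set" and \<epsilon> :: "'h \<Rightarrow> 'k"
    and \<delta> :: "'a \<Rightarrow> ('h \<times> 'a \<Rightarrow>\<^sub>0 int) set"
    and \<Theta> :: "('h \<times> 'm \<Rightarrow>\<^sub>0 int) set \<Rightarrow> (('h \<times> 'a \<Rightarrow>\<^sub>0 int) set \<times> 'm \<Rightarrow>\<^sub>0 int) set"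
    and \<delta>bar :: "'m \<Rightarrow> ('h \<times> 'm \<Rightarrow>\<^sub>0 int) set"
  assumes "field K"
    and "bialgebra K H \<Delta> \<epsilon>"
    and "assoc_algebra K A"
    and "left_coaction K H \<Delta> \<epsilon> A \<delta>"
    and "left_module A M"
    and "\<Theta> \<in> left_module_hom (tensor_algebra K H A) (tensor_module K H A M)
                (ext_module A (tensor_algebra K H A) \<delta> M)"
    and "bij_betw \<Theta> (carrier (tensor_module K H A M))
           (carrier (ext_module A (tensor_algebra K H A) \<delta> M))"
    and "\<And>m. m \<in> carrier M \<Longrightarrow> \<delta>bar m =
           inv_into (carrier (tensor_module K H A M)) \<Theta>
             (ext_natural A (tensor_algebra K H A) \<delta> M m)"
  shows "(\<forall>m\<in>carrier M. counit_pullback K H \<epsilon> A \<delta> M \<Theta> m = m)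
    \<longleftrightarrow> (\<forall>m\<in>carrier M. counit_tensor_id K \<epsilon> (scalar_module A M) (\<delta>bar m) = m)"
proof -
  interpret left_coaction K H \<Delta> \<epsilon> A \<delta> by fact
  interpret coaction_module K H \<Delta> \<epsilon> A \<delta> M
    by (intro coaction_module.intro) fact+
  \<comment> \<open>Surjectivity of \<open>\<Theta>\<close> makes \<open>\<delta>bar m\<close> a
    genuine preimage of \<open>1 \<otimes> m\<close>, and \<open>\<rho>\<close> sends
    \<open>1 \<otimes> m\<close> back to \<open>m\<close>.\<close>
  have \<delta>bar: "\<delta>bar m \<in> carrier HM" "\<rho> (\<Theta> (\<delta>bar m)) = m" if m: "m \<in> carrier M" for m
  proof -
    have "ext_natural A HA \<delta> M m \<in> \<Theta> ` carrier HM"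
      using assms(7) m by (simp add: bij_betw_def ext_natural_def D.ext_elem_closed)
    then show "\<delta>bar m \<in> carrier HM" "\<rho> (\<Theta> (\<delta>bar m)) = m"
      using m by (simp_all add: assms(8) inv_into_into f_inv_into_f \<rho>_natural)
  qed
  \<comment> \<open>The left side is the pullback of \<open>\<Theta>\<close> evaluated at
    \<open>\<pi> (\<delta>bar m)\<close>, so \<open>\<pi> \<circ> \<delta>bar\<close> is a right
    inverse of the pullback.\<close>
  have key: "\<rho> (\<Theta> (\<iota> (\<pi> (\<delta>bar m)))) = m" if "m \<in> carrier M" for m
    using \<rho>_\<Theta>[OF assms(6)] \<delta>bar[OF that] by simp
  show ?thesis
  proof (intro iffI ballI)
    fix m assume P: "\<forall>m\<in>carrier M. counit_pullback K H \<epsilon> A \<delta> M \<Theta> m = m" and m: "m \<in> carrier M"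
    show "\<pi> (\<delta>bar m) = m"
      \<comment> \<open>Here \<open>P\<close> is applied at \<open>\<pi> (\<delta>bar m)\<close>
        rather than at \<open>m\<close>; this element lies in \<open>M\<close>, and
        \<open>key\<close> gives the other value of the pullback there.\<close>
      using P \<pi>_closed[OF \<delta>bar(1)[OF m]] key[OF m] counit_pullback_eq[OF assms(6)] by metis
  next
    fix m assume "\<forall>m\<in>carrier M. \<pi> (\<delta>bar m) = m" and m: "m \<in> carrier M"
    then have "\<pi> (\<delta>bar m) = m"
      by blast
    with key[OF m] show "counit_pullback K H \<epsilon> A \<delta> M \<Theta> m = m"
      by (simp only: counit_pullback_eq[OF assms(6) m])
  qed
qed

end
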